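(* (a) Let $u\in\mathcal{C}(\mathbb{R}^d)\cap L^1(\omega)$ satisfy $$\mathbf{I}u+\mu u\ge0\ \text{in }\Omega,\qquad u\le0\ \text{in }\Omega^c,$$ for some $\mu<\Lambda^+$. Then $u\le0$ in $\mathbb{R}^d$. (b) Let $u\in\mathcal{C}(\mathbb{R}^d)\cap L^1(\omega)$ satisfy $$\mathbf{I}u+\mu u\le0\ \text{in }\Omega,\qquad u\ge0\ \text{in }\Omega^c,$$ for some $\mu<\Lambda^-$. Then $u\ge0$ in $\mathbb{R}^d$.
   Context: Fix the dimension $d$, $s\in(0,1)$ and $0<\lambda\le\Lambda$. Let $\mathcal{L}_*$ be the class of all operators $$Lu(x)=\frac12\int_{\mathbb{R}^d}\bigl(u(x+y)+u(x-y)-2u(x)\bigr)\frac{k(y/|y|)}{|y|^{d+2s}}\,dy,$$ where $k\in L^\infty(S^{d-1})$, $\lambda\le k\le\Lambda$ and $k(y)=k(-y)$. Let $\mathcal{L}\subset\mathcal{L}_*$ be a nonempty subclass and $\mathbf{I}u=\sup_{L\in\mathcal{L}}Lu$. $\Omega\subset\mathbb{R}^d$ is a bounded (connected) domain with smooth boundary. $L^1(\omega)$ is the set of functions integrable with respect to the weight $\omega(y)=(1+|y|)^{-d-2s}$. All (in)equalities are in the viscosity sense: $\mathbf{I}u\ge f$ in $\Omega$ means that whenever $x_0\in\Omega$, $N\subset\Omega$ is a neighbourhood of $x_0$, and $\varphi\in\mathcal{C}^2(\bar N)$ satisfies $\varphi(x_0)=u(x_0)$ and $\varphi>u$ in $N\setminus\{x_0\}$,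 the function $v$ equal to $\varphi$ in $N$ and $u$ in $N^c$ satisfies $\mathbf{I}v(x_0)\ge f(x_0)$; $\mathbf{I}u\le f$ is defined symmetrically (touching from below, reversed inequality), and $\mathbf{I}u=f$ means both. Define $$\Lambda^+=\sup\{\mu\in\mathbb{R}:\exists\,\psi\in\mathcal{C}(\mathbb{R}^d)\cap L^1(\omega),\ \psi\ge0,\ \psi>0\text{ in }\Omega,\ \mathbf{I}\psi+\mu\psi\le0\text{ in }\Omega\},$$ $$\Lambda^-=\sup\{\mu\in\mathbb{R}:\exists\,\psi\in\mathcal{C}(\mathbb{R}^d)\cap L^1(\omega),\ \psi\le0,\ \psi<0\text{ in }\Omega,\ \mathbf{I}\psi+\mu\psi\ge0\text{ in }\Omega\}.$$ *)

theory Defs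
  imports "HOL-Analysis.Analysis"
begin

text \<open>The ambient space \<open>\<real>\<^sup>d\<close> is an arbitrary type of class \<open>euclidean_space\<close>, with \<open>d = DIM('a)\<close>.\<close>

subsection \<open>Functions of class \<open>C\<^sup>k\<close>\<close>

text \<open>Both notions below are meant for open sets only.\<close>

primrec Ck_on :: "nat \<Rightarrow> ('a::euclidean_space \<Rightarrow> real) \<Rightarrow> 'a set \<Rightarrow> bool" where
  "Ck_on 0 f S \<longleftrightarrow> continuous_on S f"
| "Ck_on (Suc k) f S \<longleftrightarrow>
     (\<forall>x\<in>S. f differentiable (at x)) \<and>
     (\<forall>b\<in>Basis. Ck_on k (\<lambda>x. frechet_derivative f (at x) b) S)"

definition smooth_fun_on :: "('a::euclidean_space \<Rightarrow> real) \<Rightarrow> 'a set \<Rightarrow> bool" where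
  "smooth_fun_on f S \<longleftrightarrow> (\<forall>k. Ck_on k f S)"

text \<open>\<open>Ck_closure k f N\<close> is \<open>f \<in> C\<^sup>k(closure N)\<close> in the usual sense: \<open>f\<close> is \<open>C\<^sup>k\<close> in the open
  set \<open>N\<close>, and all partial derivatives of order at most \<open>k\<close> have continuous extensions to the
  closure. Values of \<open>f\<close> outside \<open>N\<close> are irrelevant.\<close>

primrec Ck_closure :: "nat \<Rightarrow> ('a::euclidean_space \<Rightarrow> real) \<Rightarrow> 'a set \<Rightarrow> bool" where
  "Ck_closure 0 f N \<longleftrightarrow> (\<exists>g. continuous_on (closure N) g \<and> (\<forall>x\<in>N. g x = f x))"
| "Ck_closure (Suc k) f N \<longleftrightarrow>
     (\<exists>g. continuous_on (closure N) g \<and> (\<forall>x\<in>N. g x = f x)) \<and>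
     (\<forall>x\<in>N. f differentiable (at x)) \<and>
     (\<forall>b\<in>Basis. Ck_closure k (\<lambda>x. frechet_derivative f (at x) b) N)"

subsection \<open>Bounded domains with smooth boundary\<close>

text \<open>Near each boundary point, in a direction \<open>e\<close>, the set is the strict epigraph of a smooth
  function \<open>\<gamma>\<close> of the component orthogonal to \<open>e\<close>. Only the values of \<open>\<gamma>\<close> on the
  hyperplane orthogonal to \<open>e\<close> matter; a smooth function on that hyperplane extends smoothly to
  the whole space by composition with the orthogonal projection.\<close>

definition smooth_boundary :: "'a::euclidean_space set \<Rightarrow> bool" where
  "smooth_boundary \<Omega> \<longleftrightarrow>
     (\<forall>x0\<in>frontier \<Omega>. \<exists>r>0. \<exists>e \<gamma>. norm e = 1 \<and> smooth_fun_on \<gamma> UNIV \<and>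
        \<Omega> \<inter> ball x0 r = {x \<in> ball x0 r. x \<bullet> e > \<gamma> (x - (x \<bullet> e) *\<^sub>R e)})"

definition smooth_bounded_domain :: "'a::euclidean_space set \<Rightarrow> bool" where
  "smooth_bounded_domain \<Omega> \<longleftrightarrow>
     open \<Omega> \<and> \<Omega> \<noteq> {} \<and> connected \<Omega> \<and> bounded \<Omega> \<and> smooth_boundary \<Omega>"

subsection \<open>The operators\<close>

text \<open>Here \<open>sgn y = y / norm y\<close>. The value of the integrand at \<open>y = 0\<close> is immaterial.\<close>

definition levy_op :: "real \<Rightarrow> ('a::euclidean_space \<Rightarrow> real) \<Rightarrow> ('a \<Rightarrow> real) \<Rightarrow> 'a \<Rightarrow> real" where
  "levy_op s k u x =
     1 / 2 * (LINT y|lborel. (u (x + y) + u (x - y) - 2 * u x) *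
                (k (sgn y) / norm y powr (real DIM('a) + 2 * s)))"

text \<open>A kernel, an element of \<open>L\<^sup>\<infinity>\<close> of the unit sphere, is given by a Borel representative that
  satisfies the bounds and the symmetry everywhere. Every class satisfying them almost everywhere
  has such a representative, and the operator depends on the class only.\<close>

definition admissible_kernel :: "real \<Rightarrow> real \<Rightarrow> ('a::euclidean_space \<Rightarrow> real) \<Rightarrow> bool" where
  "admissible_kernel lam Lam k \<longleftrightarrow>
     k \<in> borel_measurable (restrict_space borel (sphere 0 1)) \<and>
     (\<forall>\<theta>\<in>sphere 0 1. lam \<le> k \<theta> \<and> k \<theta> \<le> Lam \<and> k \<theta> = k (- \<theta>))"

definition L_star ::
  "real \<Rightarrow> real \<Rightarrow> real \<Rightarrow> (('a::euclidean_space \<Rightarrow> real) \<Rightarrow> 'a \<Rightarrow> real) set" where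
  "L_star s lam Lam = {levy_op s k | k. admissible_kernel lam Lam k}"

text \<open>The operator \<open>I\<close> is only evaluated at functions that are \<open>C\<^sup>2\<close> near \<open>x\<close> and integrable
  against the weight below. For these the integrals defining \<open>L u x\<close> converge absolutely and are
  bounded uniformly over \<open>L_star s lam Lam\<close>, so that the real supremum is the true one.\<close>

definition sup_op ::
  "(('a::euclidean_space \<Rightarrow> real) \<Rightarrow> 'a \<Rightarrow> real) set \<Rightarrow> ('a \<Rightarrow> real) \<Rightarrow> 'a \<Rightarrow> real" where
  "sup_op LL u x = (SUP L\<in>LL. L u x)"

definition L1_weight :: "real \<Rightarrow> ('a::euclidean_space \<Rightarrow> real) set" where
  "L1_weight s =
     {u. integrable lborel (\<lambda>y. u y * (1 + norm y) powr (- real DIM('a) - 2 * s))}"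

subsection \<open>Viscosity inequalities\<close>

definition visc_ge ::
  "(('a::euclidean_space \<Rightarrow> real) \<Rightarrow> 'a \<Rightarrow> real) set \<Rightarrow> 'a set \<Rightarrow> ('a \<Rightarrow> real) \<Rightarrow> ('a \<Rightarrow> real) \<Rightarrow> bool" where
  "visc_ge LL \<Omega> u f \<longleftrightarrow>
     (\<forall>x0 N \<phi>. x0 \<in> \<Omega> \<and> open N \<and> x0 \<in> N \<and> N \<subseteq> \<Omega> \<and> Ck_closure 2 \<phi> N \<and>
        \<phi> x0 = u x0 \<and> (\<forall>x\<in>N - {x0}. \<phi> x > u x) \<longrightarrow>
        sup_op LL (\<lambda>x. if x \<in> N then \<phi> x else u x) x0 \<ge> f x0)"

definition visc_le ::
  "(('a::euclidean_space \<Rightarrow> real) \<Rightarrow> 'a \<Rightarrow> real) set \<Rightarrow> 'a set \<Rightarrow> ('a \<Rightarrow> real) \<Rightarrow> ('a \<Rightarrow> real) \<Rightarrow> bool" where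
  "visc_le LL \<Omega> u f \<longleftrightarrow>
     (\<forall>x0 N \<phi>. x0 \<in> \<Omega> \<and> open N \<and> x0 \<in> N \<and> N \<subseteq> \<Omega> \<and> Ck_closure 2 \<phi> N \<and>
        \<phi> x0 = u x0 \<and> (\<forall>x\<in>N - {x0}. \<phi> x < u x) \<longrightarrow>
        sup_op LL (\<lambda>x. if x \<in> N then \<phi> x else u x) x0 \<le> f x0)"

subsection \<open>The principal half-eigenvalues\<close>

text \<open>\<open>I \<psi> + \<mu> \<psi> \<le> 0\<close> is read as \<open>I \<psi> \<le> f\<close> with \<open>f = - \<mu> \<psi>\<close>. The suprema are taken in
  the extended reals.\<close>

definition Lambda_plus ::
  "real \<Rightarrow> (('a::euclidean_space \<Rightarrow> real) \<Rightarrow> 'a \<Rightarrow> real) set \<Rightarrow> 'a set \<Rightarrow> ereal" where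
  "Lambda_plus s LL \<Omega> = Sup (ereal ` {\<mu>. \<exists>\<psi>. continuous_on UNIV \<psi> \<and> \<psi> \<in> L1_weight s \<and>
      (\<forall>x. \<psi> x \<ge> 0) \<and> (\<forall>x\<in>\<Omega>. \<psi> x > 0) \<and> visc_le LL \<Omega> \<psi> (\<lambda>x. - \<mu> * \<psi> x)})"

definition Lambda_minus ::
  "real \<Rightarrow> (('a::euclidean_space \<Rightarrow> real) \<Rightarrow> 'a \<Rightarrow> real) set \<Rightarrow> 'a set \<Rightarrow> ereal" where
  "Lambda_minus s LL \<Omega> = Sup (ereal ` {\<mu>. \<exists>\<psi>. continuous_on UNIV \<psi> \<and> \<psi> \<in> L1_weight s \<and>
      (\<forall>x. \<psi> x \<le> 0) \<and> (\<forall>x\<in>\<Omega>. \<psi> x < 0) \<and> visc_ge LL \<Omega> \<psi> (\<lambda>x. - \<mu> * \<psi> x)})"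

end

theory Submission
  imports Defs
begin

text \<open>
  Write \<open>P = d + 2s\<close>. Let \<open>u\<close> be a subsolution for \<open>\<mu>\<close>, positive somewhere, and let \<open>\<psi> \<ge> 0\<close> be
  a supersolution, positive in \<open>\<Omega>\<close>, for some \<open>\<mu>' > \<mu>\<close>; it exists by the definition of the
  half-eigenvalue. Suppose that \<open>u - t \<psi>\<close> has a positive maximum \<open>m\<close>, for some \<open>t > 0\<close>. It is attained at some \<open>x \<in> \<Omega>\<close>, and
  formally a single operator \<open>L\<close> of the class gives
  \<open>- \<mu> u x + \<mu>' t \<psi> x \<le> L (u - t \<psi>) x \<le> - c m \<nu>\<close>, where \<open>\<nu>\<close> is the mass that \<open>\<bar>z\<bar>\<^sup>-\<^sup>P dz\<close> gives to those
  \<open>z\<close> with \<open>(u - t \<psi>) (x + z) \<le> 0\<close>. Since \<open>u x = m + t \<psi> x\<close>, this reads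
  \<open>(c \<nu> - \<mu>) m + (\<mu>' - \<mu>) t \<psi> x \<le> 0\<close>, and it is exploited twice.

  If \<open>K \<subseteq> \<Omega>\<close> is compact with \<open>\<Omega> - K\<close> of small measure and \<open>t\<close> is so large that \<open>t \<psi> > u\<close> on \<open>K\<close>, then
  \<open>u - t \<psi>\<close> can be positive only on the small set \<open>\<Omega> - K\<close>, so that \<open>c \<nu> \<ge> \<mu>\<close>: a contradiction. This
  maximum principle in narrow sets gives \<open>u \<le> t \<psi>\<close> for some \<open>t\<close>, although \<open>\<psi>\<close> may vanish on
  the boundary (\<open>some_multiple_dominates\<close>).

  If \<open>u \<le> t\<^sub>1 \<psi>\<close> and \<open>t < t\<^sub>1\<close> is close to \<open>t\<^sub>1\<close>, then \<open>m \<le> (t\<^sub>1 - t) \<psi> x\<close>, which makes \<open>\<mu> m\<close> smaller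
  than \<open>(\<mu>' - \<mu>) t \<psi> x\<close>: again a contradiction, so \<open>u \<le> t \<psi>\<close>. The admissible ratio \<open>t / t\<^sub>1 < 1\<close> depends on
  \<open>\<mu>\<close> and \<open>\<mu>'\<close> only, and iteration gives \<open>u \<le> 0\<close> (\<open>smaller_multiple_dominates\<close>).

  As \<open>u\<close> and \<open>\<psi>\<close> are merely continuous, the inequality is derived by doubling the variables: at a
  maximum \<open>(x, y)\<close> of \<open>U a - t \<Psi> b - \<kappa> \<bar>a - b\<bar>\<^sup>2\<close> paraboloids touch both functions. As the operators are
  invariant under translations and the penalty is invariant under simultaneous translation of both
  arguments, the nonlocal parts compare directly, while the contribution of the paraboloids on a ball
  of radius \<open>\<delta>\<close> vanishes as \<open>\<delta> \<rightarrow> 0\<close> because the order \<open>2s\<close> is below \<open>2\<close>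
  (\<open>doubled_maximum_inequality\<close>).

  The two parts of the theorem differ only in which of the two viscosity inequalities provides a
  nearly optimal operator and which one holds for all operators. After replacing \<open>(u, \<psi>)\<close> by \<open>(- u, - \<psi>)\<close>
  in the second part, both reduce to the same property \<open>common_kernel\<close>.
\<close>

section \<open>Integrability of powers of the norm\<close>

lemma dyadic_bracket:
  fixes y :: real
  assumes "1 \<le> y"
  shows "\<exists>n::nat. 2 ^ n \<le> y \<and> y < 2 ^ Suc n"
proof -
  have ex: "\<exists>n::nat. y < 2 ^ n"
    by (rule real_arch_pow) simp
  define m where "m = (LEAST n::nat. y < 2 ^ n)"
  have m: "y < 2 ^ m"
    unfolding m_def by (rule LeastI_ex) (rule ex)
  with assms obtain n where n: "m = Suc n"
    by (cases m) auto
  have "\<not> y < 2 ^ n"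
    using not_less_Least[of n "\<lambda>n. y < 2 ^ n"] n unfolding m_def by simp
  with m n show ?thesis by force
qed

text \<open>A pointwise bound by one member of a series of step functions on balls. For a power of the norm
  the balls are dyadic, \<open>c n\<close> is up to a constant its size on the \<open>n\<close>-th dyadic shell, and the series is
  geometric because the volume of a ball scales like the \<open>d\<close>-th power of its radius.\<close>

lemma integrable_by_shells:
  fixes f :: "'a::euclidean_space \<Rightarrow> real" and c \<rho> :: "nat \<Rightarrow> real"
  assumes meas: "f \<in> borel_measurable borel" and nonneg: "\<And>z. 0 \<le> f z"
    and c: "\<And>n. 0 \<le> c n" and \<rho>: "\<And>n. 0 \<le> \<rho> n"
    and bound: "\<And>z. \<exists>n. f z \<le> c n * indicator (ball 0 (\<rho> n)) z"
    and sum: "summable (\<lambda>n. c n * \<rho> n ^ DIM('a))"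
  shows "integrable lborel f"
proof (rule integrableI_nonneg)
  show "f \<in> borel_measurable lborel" using meas by simp
  show "AE z in lborel. 0 \<le> f z" using nonneg by simp
  have 1: "(\<integral>\<^sup>+z. ennreal (f z) \<partial>lborel) \<le> (\<integral>\<^sup>+z. (\<Sum>n. ennreal (c n) * indicator (ball (0::'a) (\<rho> n)) z) \<partial>lborel)"
  proof (rule nn_integral_mono)
    fix z :: 'a
    obtain n where "f z \<le> c n * indicator (ball 0 (\<rho> n)) z" using bound by blast
    then have "ennreal (f z) \<le> ennreal (c n) * indicator (ball 0 (\<rho> n)) z"
      by (auto simp: indicator_def ennreal_neg intro!: ennreal_leI split: if_splits)
    also have "\<dots> \<le> (\<Sum>n. ennreal (c n) * indicator (ball 0 (\<rho> n)) z)"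
    proof -
      define F where "F = (\<lambda>n. ennreal (c n) * indicator (ball 0 (\<rho> n)) z)"
      have "sum F {n} \<le> suminf F" by (rule sum_le_suminf) auto
      then have "F n \<le> suminf F" by simp
      then show ?thesis unfolding F_def .
    qed
    finally show "ennreal (f z) \<le> (\<Sum>n. ennreal (c n) * indicator (ball 0 (\<rho> n)) z)" .
  qed
  have 2: "(\<integral>\<^sup>+z. (\<Sum>n. ennreal (c n) * indicator (ball (0::'a) (\<rho> n)) z) \<partial>lborel)
      = (\<Sum>n. ennreal (c n) * emeasure lborel (ball (0::'a) (\<rho> n)))"
  proof (subst nn_integral_suminf)
    show "(\<lambda>z. ennreal (c i) * indicator (ball (0::'a) (\<rho> i)) z) \<in> borel_measurable lborel" for i
      unfolding measurable_lborel1
      by (intro borel_measurable_times_ennreal borel_measurable_indicator borel_measurable_const) auto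
  qed (simp add: nn_integral_cmult_indicator)
  have 3: "ennreal (c n) * emeasure lborel (ball (0::'a) (\<rho> n))
      = ennreal (unit_ball_vol DIM('a) * (c n * \<rho> n ^ DIM('a)))" for n
    using c[of n] \<rho>[of n] by (simp add: emeasure_ball ennreal_mult[symmetric] mult_ac)
  have 4: "(\<Sum>n. ennreal (unit_ball_vol DIM('a) * (c n * \<rho> n ^ DIM('a)))) < \<infinity>"
    using sum c \<rho> by (subst suminf_ennreal2) (auto intro!: summable_mult)
  show "(\<integral>\<^sup>+z. ennreal (f z) \<partial>lborel) < \<infinity>"
    using 1 2 3 4 by (simp add: le_less_trans)
qed

lemma integrable_norm_powr_ball:
  fixes q :: real
  assumes "- real DIM('a) < q"
  shows "integrable lborel (\<lambda>z::'a::euclidean_space. indicator (ball 0 1) z * norm z powr q)"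
proof (rule integrable_by_shells[where c="\<lambda>n. 2 powr \<bar>q\<bar> * (2 powr - q) ^ n" and \<rho>="\<lambda>n. 2 * (1/2) ^ n"])
  show "(\<lambda>z::'a. indicator (ball 0 1) z * norm z powr q) \<in> borel_measurable borel"
    by (intro borel_measurable_times borel_measurable_indicator powr_real_measurable) auto
  show "summable (\<lambda>n. 2 powr \<bar>q\<bar> * (2 powr - q) ^ n * (2 * (1 / 2) ^ n) ^ DIM('a))"
  proof -
    have "2 powr - q * (1/2) ^ DIM('a) = 2 powr (- q - real DIM('a))"
      by (simp add: powr_diff powr_realpow power_divide)
    also have "\<dots> < 1" using assms by (simp add: powr_less_one)
    finally have "summable (\<lambda>n. (2 powr - q * (1/2) ^ DIM('a)) ^ n)"
      by (intro summable_geometric) simp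
    then have "summable (\<lambda>n. 2 powr \<bar>q\<bar> * 2 ^ DIM('a) * (2 powr - q * (1/2) ^ DIM('a)) ^ n)"
      by (rule summable_mult)
    then show ?thesis
      by (simp add: power_mult_distrib power_mult[symmetric] mult_ac)
  qed
  fix z :: 'a
  show "\<exists>n. indicator (ball 0 1) z * norm z powr q
      \<le> 2 powr \<bar>q\<bar> * (2 powr - q) ^ n * indicator (ball 0 (2 * (1 / 2) ^ n)) z"
  proof (cases "z \<noteq> 0 \<and> norm z < 1")
    case True
    then obtain n where n: "2 ^ n \<le> 1 / norm z" "1 / norm z < 2 ^ Suc n"
      using dyadic_bracket[of "1 / norm z"] by auto
    \<comment> \<open>The factor \<open>2 powr \<bar>q\<bar>\<close> absorbs the variation of the power on one shell, for either sign of \<open>q\<close>.\<close>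
    define a where "a = norm z * 2 ^ n"
    have a: "1/2 < a" "a \<le> 1" and z: "norm z = a * (1/2) ^ n"
      using n True by (auto simp: a_def field_simps power_divide)
    have "a powr q \<le> 2 powr \<bar>q\<bar>"
    proof (cases "0 \<le> q")
      case True
      then have "a powr q \<le> 1" using a by (intro powr_le1) auto
      also have "1 \<le> 2 powr \<bar>q\<bar>" by (rule ge_one_powr_ge_zero) auto
      finally show ?thesis .
    next
      case False
      then have "a powr q \<le> (1/2) powr q" using a by (intro powr_mono2') auto
      also have "\<dots> = 2 powr \<bar>q\<bar>" using False by (simp add: powr_divide powr_minus field_simps)
      finally show ?thesis .
    qed
    moreover have "norm z powr q = a powr q * (2 powr - q) ^ n"
      using a by (simp add: z powr_mult powr_power powr_realpow[symmetric] powr_powr powr_divide powr_minus field_simps)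
    moreover have "norm z < 2 * (1/2) ^ n" using a by (simp add: z)
    ultimately show ?thesis
      using True by (intro exI[of _ n]) (auto intro!: mult_right_mono)
  qed (auto simp: intro!: exI[of _ 0])
qed (auto)

lemma integrable_one_plus_norm_powr:
  fixes q :: real
  assumes "q < - real DIM('a)"
  shows "integrable lborel (\<lambda>z::'a::euclidean_space. (1 + norm z) powr q)"
proof (rule integrable_by_shells[where c="\<lambda>n. (2 powr q) ^ n" and \<rho>="\<lambda>n. 2 * 2 ^ n"])
  show "(\<lambda>z::'a. (1 + norm z) powr q) \<in> borel_measurable borel" by measurable
  show "summable (\<lambda>n. (2 powr q) ^ n * (2 * 2 ^ n) ^ DIM('a))"
  proof -
    have "2 powr q * 2 ^ DIM('a) = 2 powr (q + real DIM('a))"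
      by (simp add: powr_add powr_realpow)
    also have "\<dots> < 1" using assms by (simp add: powr_less_one)
    finally have "summable (\<lambda>n. (2 powr q * 2 ^ DIM('a)) ^ n)"
      by (intro summable_geometric) simp
    then have "summable (\<lambda>n. 2 ^ DIM('a) * (2 powr q * 2 ^ DIM('a)) ^ n)"
      by (rule summable_mult)
    then show ?thesis
      by (simp add: power_mult_distrib power_mult[symmetric] mult_ac)
  qed
  fix z :: 'a
  obtain n where n: "2 ^ n \<le> 1 + norm z" "1 + norm z < 2 ^ Suc n"
    using dyadic_bracket[of "1 + norm z"] by auto
  have "(1 + norm z) powr q \<le> (2 ^ n) powr q"
    using n assms by (intro powr_mono2') auto
  also have "\<dots> = (2 powr q) ^ n"
    by (simp add: powr_power powr_realpow[symmetric] powr_powr mult.commute)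
  finally show "\<exists>n. (1 + norm z) powr q \<le> (2 powr q) ^ n * indicator (ball 0 (2 * 2 ^ n)) z"
    using n by (intro exI[of _ n]) auto
qed (auto)

section \<open>The operators on paraboloid test functions\<close>

definition second_diff :: "('a::euclidean_space \<Rightarrow> real) \<Rightarrow> 'a \<Rightarrow> 'a \<Rightarrow> real" where
  "second_diff u x z = u (x + z) + u (x - z) - 2 * u x"

text \<open>The test functions of the viscosity definition: a paraboloid near the contact point and the
  given function elsewhere. Paraboloids are the only smooth functions that the proof uses as
  test functions.\<close>

definition quad_patch :: "('a::euclidean_space \<Rightarrow> real) \<Rightarrow> 'a \<Rightarrow> 'a \<Rightarrow> real \<Rightarrow> real \<Rightarrow> 'a \<Rightarrow> real" where
  "quad_patch u x p c \<delta> = (\<lambda>z. if z \<in> ball x \<delta> then u x + p \<bullet> (z - x) + c * (norm (z - x))\<^sup>2 else u z)"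

text \<open>Symmetric second differences annihilate the linear term, and for \<open>norm z \<ge> \<delta>\<close> both points
  \<open>x + z\<close> and \<open>x - z\<close> lie outside the ball of the paraboloid.\<close>

lemma second_diff_quad_patch:
  assumes "0 < \<delta>"
  shows "second_diff (quad_patch u x p c \<delta>) x z =
    (if norm z < \<delta> then 2 * c * (norm z)\<^sup>2 else second_diff u x z)"
  using assms by (auto simp: second_diff_def quad_patch_def dist_norm inner_diff_right inner_add_right)

lemma levy_op_second_diff:
  "levy_op s k u (x::'a::euclidean_space) =
    1 / 2 * (LINT z|lborel. second_diff u x z * (k (sgn z) / norm z powr (real DIM('a) + 2 * s)))"
  by (simp add: levy_op_def second_diff_def)

lemma lborel_distr_isometry:
  fixes x :: "'a::euclidean_space"
  assumes "\<bar>\<sigma>\<bar> = 1"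
  shows "distr lborel borel (\<lambda>z. x + \<sigma> *\<^sub>R z) = lborel"
proof -
  have "lborel = density (distr lborel borel (\<lambda>z. x + \<sigma> *\<^sub>R z)) (\<lambda>_. ennreal (\<bar>\<sigma>\<bar> ^ DIM('a)))"
    using assms by (intro lborel_affine) auto
  also have "\<dots> = distr lborel borel (\<lambda>z. x + \<sigma> *\<^sub>R z)"
    using assms by (simp add: density_1)
  finally show ?thesis ..
qed

lemma integrable_lborel_isometry:
  fixes f :: "'a::euclidean_space \<Rightarrow> real"
  assumes "integrable lborel f" "\<bar>\<sigma>\<bar> = 1"
  shows "integrable lborel (\<lambda>z. f (x + \<sigma> *\<^sub>R z))"
proof -
  have "integrable (distr lborel borel (\<lambda>z. x + \<sigma> *\<^sub>R z)) f"
    using assms by (simp add: lborel_distr_isometry)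
  moreover have "f \<in> borel_measurable borel" using assms(1) by auto
  ultimately show ?thesis by (subst (asm) integrable_distr_eq) auto
qed

lemma integral_lborel_isometry:
  fixes f :: "'a::euclidean_space \<Rightarrow> real"
  assumes "f \<in> borel_measurable borel" "\<bar>\<sigma>\<bar> = 1"
  shows "(LINT z|lborel. f (x + \<sigma> *\<^sub>R z)) = (LINT z|lborel. f z)"
proof -
  have "(LINT z|lborel. f z) = (LINT z|distr lborel borel (\<lambda>z. x + \<sigma> *\<^sub>R z). f z)"
    by (simp add: lborel_distr_isometry[OF assms(2)])
  also have "\<dots> = (LINT z|lborel. f (x + \<sigma> *\<^sub>R z))"
    using assms(1) by (subst integral_distr) auto
  finally show ?thesis by simp
qed

text \<open>Away from the singularity the kernel is comparable with the weight of \<open>L1_weight\<close>, recentred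
  at any point.\<close>

lemma norm_powr_le_weight:
  fixes x z :: "'a::euclidean_space"
  assumes "0 < \<delta>" "\<delta> \<le> norm z" "0 \<le> P" "\<bar>\<sigma>\<bar> = 1"
  shows "1 / norm z powr P \<le> ((1 + norm x) / \<delta> + 1) powr P * (1 + norm (x + \<sigma> *\<^sub>R z)) powr (- P)"
proof -
  have z: "norm z > 0" using assms by linarith
  have "1 + norm (x + \<sigma> *\<^sub>R z) \<le> (1 + norm x) + norm z"
    using norm_triangle_ineq[of x "\<sigma> *\<^sub>R z"] assms(4) by simp
  also have "1 + norm x \<le> (1 + norm x) / \<delta> * norm z"
  proof -
    have "(1 + norm x) * \<delta> \<le> (1 + norm x) * norm z" using assms by (intro mult_left_mono) auto
    then show ?thesis using assms(1) by (simp add: field_simps)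
  qed
  finally have "1 + norm (x + \<sigma> *\<^sub>R z) \<le> ((1 + norm x) / \<delta> + 1) * norm z"
    by (simp add: algebra_simps)
  then have "(1 + norm (x + \<sigma> *\<^sub>R z)) powr P \<le> (((1 + norm x) / \<delta> + 1) * norm z) powr P"
    using assms by (intro powr_mono2) auto
  also have "\<dots> = ((1 + norm x) / \<delta> + 1) powr P * norm z powr P"
    by (rule powr_mult)
  finally have *: "(1 + norm (x + \<sigma> *\<^sub>R z)) powr P \<le> ((1 + norm x) / \<delta> + 1) powr P * norm z powr P" .
  have "(1 + norm (x + \<sigma> *\<^sub>R z)) powr P > 0"
    using add_pos_nonneg[of 1 "norm (x + \<sigma> *\<^sub>R z)"] by simp
  then show ?thesis
    using * z by (simp add: powr_minus field_simps)
qed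

lemma integrable_shift_tail:
  fixes u :: "'a::euclidean_space \<Rightarrow> real"
  assumes u: "continuous_on UNIV u" "u \<in> L1_weight s" and "0 < s" "0 < \<delta>" "\<bar>\<sigma>\<bar> = 1"
  shows "integrable lborel (\<lambda>z. indicator (- ball 0 \<delta>) z * u (x + \<sigma> *\<^sub>R z) / norm z powr (real DIM('a) + 2 * s))"
proof -
  define P where "P = real DIM('a) + 2 * s"
  define C where "C = ((1 + norm x) / \<delta> + 1) powr P"
  have um: "u \<in> borel_measurable borel" using u(1) by (rule borel_measurable_continuous_onI)
  have "integrable lborel (\<lambda>w. u w * (1 + norm w) powr (- P))"
    using u(2) by (simp add: L1_weight_def P_def algebra_simps)
  from integrable_lborel_isometry[OF this assms(5), of x]
  have int: "integrable lborel (\<lambda>z. C * (u (x + \<sigma> *\<^sub>R z) * (1 + norm (x + \<sigma> *\<^sub>R z)) powr (- P)))"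
    by simp
  show ?thesis unfolding P_def[symmetric]
  proof (rule Bochner_Integration.integrable_bound[OF int])
    have [measurable]: "(\<lambda>z. u (x + \<sigma> *\<^sub>R z)) \<in> borel_measurable borel"
      using um by (rule measurable_compose[rotated]) simp
    have [measurable]: "(indicator (- ball 0 \<delta>) :: 'a \<Rightarrow> real) \<in> borel_measurable borel"
      by (intro borel_measurable_indicator) auto
    show "(\<lambda>z. indicator (- ball 0 \<delta>) z * u (x + \<sigma> *\<^sub>R z) / norm z powr P) \<in> borel_measurable lborel"
      by simp
    show "AE z in lborel. norm (indicator (- ball 0 \<delta>) z * u (x + \<sigma> *\<^sub>R z) / norm z powr P)
        \<le> norm (C * (u (x + \<sigma> *\<^sub>R z) * (1 + norm (x + \<sigma> *\<^sub>R z)) powr (- P)))"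
    proof (rule AE_I2)
      fix z :: 'a
      show "norm (indicator (- ball 0 \<delta>) z * u (x + \<sigma> *\<^sub>R z) / norm z powr P)
        \<le> norm (C * (u (x + \<sigma> *\<^sub>R z) * (1 + norm (x + \<sigma> *\<^sub>R z)) powr (- P)))"
      proof (cases "\<delta> \<le> norm z")
        case True
        have "0 \<le> P" using assms(3) by (simp add: P_def)
        from norm_powr_le_weight[OF assms(4) True this assms(5), of x]
        have "\<bar>u (x + \<sigma> *\<^sub>R z)\<bar> * (1 / norm z powr P)
          \<le> \<bar>u (x + \<sigma> *\<^sub>R z)\<bar> * (C * (1 + norm (x + \<sigma> *\<^sub>R z)) powr (- P))"
          unfolding C_def by (rule mult_left_mono) simp
        moreover have "0 \<le> C" by (simp add: C_def)
        ultimately show ?thesis using True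
          by (simp add: abs_mult mult_ac)
      qed simp
    qed
  qed
qed

lemma const_in_L1_weight:
  assumes "0 < s"
  shows "(\<lambda>_::'a::euclidean_space. c) \<in> L1_weight s"
proof -
  have "integrable lborel (\<lambda>z::'a. c * (1 + norm z) powr (- real DIM('a) - 2 * s))"
    using assms by (intro integrable_mult_right integrable_one_plus_norm_powr) simp
  then show ?thesis by (simp add: L1_weight_def)
qed

lemma sq_div_powr: "(r::real)\<^sup>2 / r powr P = r powr (2 - P)" if "0 \<le> r"
  using that by (cases "r = 0") (simp_all add: powr_diff)

lemma integrable_quad_patch:
  fixes u :: "'a::euclidean_space \<Rightarrow> real"
  assumes u: "continuous_on UNIV u" "u \<in> L1_weight s" and s: "0 < s" "s < 1" and \<delta>: "0 < \<delta>" "\<delta> \<le> 1"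
  shows "integrable lborel (\<lambda>z. second_diff (quad_patch u x p c \<delta>) x z / norm z powr (real DIM('a) + 2 * s))"
proof -
  define P where "P = real DIM('a) + 2 * s"
  have tail: "integrable lborel (\<lambda>z. indicator (- ball 0 \<delta>) z * v (x + \<sigma> *\<^sub>R z) / norm z powr P)"
    if "\<bar>\<sigma>\<bar> = 1" "continuous_on UNIV v" "v \<in> L1_weight s" for \<sigma> and v :: "'a \<Rightarrow> real"
    unfolding P_def using integrable_shift_tail[OF that(2,3) s(1) \<delta>(1) that(1)] .
  have near: "integrable lborel (\<lambda>z::'a. indicator (ball 0 \<delta>) z * norm z powr (2 - P))"
  proof (rule Bochner_Integration.integrable_bound[OF integrable_norm_powr_ball])
    show "- real DIM('a) < 2 - P" using s by (simp add: P_def)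
    show "(\<lambda>z::'a. indicator (ball 0 \<delta>) z * norm z powr (2 - P)) \<in> borel_measurable lborel"
      unfolding measurable_lborel1
      by (intro borel_measurable_times borel_measurable_indicator powr_real_measurable) auto
  qed (use \<delta> in \<open>auto simp: indicator_def\<close>)
  have "integrable lborel (\<lambda>z. 2 * c * (indicator (ball 0 \<delta>) z * norm z powr (2 - P))
      + (indicator (- ball 0 \<delta>) z * u (x + 1 *\<^sub>R z) / norm z powr P
        + indicator (- ball 0 \<delta>) z * u (x + (-1) *\<^sub>R z) / norm z powr P
        + indicator (- ball 0 \<delta>) z * (- 2 * u x) / norm z powr P))"
    by (intro Bochner_Integration.integrable_add integrable_mult_right near tail[OF _ u] tail[of 1 "\<lambda>_. - 2 * u x"]
        const_in_L1_weight s(1)) auto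
  moreover have "second_diff (quad_patch u x p c \<delta>) x z / norm z powr P =
      2 * c * (indicator (ball 0 \<delta>) z * norm z powr (2 - P))
      + (indicator (- ball 0 \<delta>) z * u (x + 1 *\<^sub>R z) / norm z powr P
        + indicator (- ball 0 \<delta>) z * u (x + (-1) *\<^sub>R z) / norm z powr P
        + indicator (- ball 0 \<delta>) z * (- 2 * u x) / norm z powr P)" for z
    unfolding second_diff_quad_patch[OF \<delta>(1)] sq_div_powr[OF norm_ge_zero, symmetric]
    by (simp add: second_diff_def indicator_def add_divide_distrib diff_divide_distrib)
  ultimately show ?thesis by (simp add: P_def)
qed

lemma admissible_kernel_measurable:
  assumes "admissible_kernel lam Lam (k::'a::euclidean_space \<Rightarrow> real)"
  shows "(\<lambda>z::'a. k (sgn z)) \<in> borel_measurable borel"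
proof -
  have sph: "sphere (0::'a) 1 \<in> sets borel" by (intro borel_closed) auto
  have k: "k \<in> borel_measurable (restrict_space borel (sphere 0 1))"
    using assms by (simp add: admissible_kernel_def)
  have "(\<lambda>\<theta>. indicator (sphere 0 1) \<theta> *\<^sub>R k \<theta>) \<in> borel_measurable borel"
    using k borel_measurable_restrict_space_iff[of "sphere 0 1" borel k] sph by simp
  then have "(\<lambda>z::'a. indicator (sphere 0 1) (sgn z) *\<^sub>R k (sgn z)) \<in> borel_measurable borel"
    by (rule measurable_compose[rotated]) (simp add: sgn_div_norm)
  then have "(\<lambda>z::'a. if z \<in> {0} then k 0 else indicator (sphere 0 1) (sgn z) *\<^sub>R k (sgn z)) \<in> borel_measurable borel"
    by (intro measurable_If_set) auto
  moreover have "(if z \<in> {0} then k 0 else indicator (sphere 0 1) (sgn z) *\<^sub>R k (sgn z)) = k (sgn z)" for z :: 'a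
    by (cases "z = 0") (simp_all add: norm_sgn)
  ultimately show ?thesis by simp
qed

lemma admissible_kernel_bounds:
  assumes "admissible_kernel lam Lam k" "z \<noteq> 0"
  shows "lam \<le> k (sgn z)" "k (sgn z) \<le> Lam"
proof -
  have "sgn z \<in> sphere 0 1" using assms(2) by (simp add: norm_sgn)
  then show "lam \<le> k (sgn z)" "k (sgn z) \<le> Lam"
    using assms(1) unfolding admissible_kernel_def by blast+
qed

text \<open>The bound is uniform over all admissible kernels. Hence the supremum defining \<open>sup_op\<close> is finite
  at the test functions, so that it really bounds each of its members.\<close>

lemma
  fixes u :: "'a::euclidean_space \<Rightarrow> real" and x p :: 'a and c :: real
  assumes u: "continuous_on UNIV u" "u \<in> L1_weight s" and s: "0 < s" "s < 1" and \<delta>: "0 < \<delta>" "\<delta> \<le> 1"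
    and k: "admissible_kernel lam Lam k" and lam: "0 < lam"
  defines "g \<equiv> \<lambda>z. second_diff (quad_patch u x p c \<delta>) x z / norm z powr (real DIM('a) + 2 * s)"
  shows integrable_levy_quad_patch: "integrable lborel
      (\<lambda>z. second_diff (quad_patch u x p c \<delta>) x z * (k (sgn z) / norm z powr (real DIM('a) + 2 * s)))"
    and levy_quad_patch_bound: "\<bar>levy_op s k (quad_patch u x p c \<delta>) x\<bar> \<le> Lam / 2 * (LINT z|lborel. \<bar>g z\<bar>)"
proof -
  have g: "integrable lborel g" unfolding g_def by (rule integrable_quad_patch[OF u s \<delta>])
  have eq: "second_diff (quad_patch u x p c \<delta>) x z * (k (sgn z) / norm z powr (real DIM('a) + 2 * s)) = g z * k (sgn z)" for z
    by (simp add: g_def)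
  have le: "\<bar>g z * k (sgn z)\<bar> \<le> Lam * \<bar>g z\<bar>" for z
  \<comment> \<open>The kernel bounds hold on the sphere only, but at \<open>z = 0\<close>, where \<open>sgn z = 0\<close>, the second difference vanishes.\<close>
  proof (cases "z = 0")
    case False
    with admissible_kernel_bounds[OF k False] lam have "\<bar>k (sgn z)\<bar> \<le> Lam" by simp
    from mult_right_mono[OF this abs_ge_zero[of "g z"]] show ?thesis
      by (simp add: abs_mult mult.commute)
  qed (simp add: g_def)
  have gk: "integrable lborel (\<lambda>z. g z * k (sgn z))"
  proof (rule Bochner_Integration.integrable_bound)
    show "integrable lborel (\<lambda>z. Lam * g z)" using g by simp
    show "(\<lambda>z. g z * k (sgn z)) \<in> borel_measurable lborel"
      using g admissible_kernel_measurable[OF k] by (intro borel_measurable_times) auto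
    have "norm (g z * k (sgn z)) \<le> norm (Lam * g z)" for z
      using le[of z] abs_ge_self[of "Lam * \<bar>g z\<bar>"] by (simp add: abs_mult)
    then show "AE z in lborel. norm (g z * k (sgn z)) \<le> norm (Lam * g z)" by simp
  qed
  then show "integrable lborel
      (\<lambda>z. second_diff (quad_patch u x p c \<delta>) x z * (k (sgn z) / norm z powr (real DIM('a) + 2 * s)))"
    unfolding eq .
  have "\<bar>LINT z|lborel. g z * k (sgn z)\<bar> \<le> (LINT z|lborel. \<bar>g z * k (sgn z)\<bar>)"
    by (rule integral_abs_bound)
  also have "\<dots> \<le> (LINT z|lborel. Lam * \<bar>g z\<bar>)"
    using gk g le by (intro integral_mono) auto
  finally show "\<bar>levy_op s k (quad_patch u x p c \<delta>) x\<bar> \<le> Lam / 2 * (LINT z|lborel. \<bar>g z\<bar>)"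
    unfolding levy_op_second_diff eq by simp
qed

section \<open>Viscosity inequalities tested with paraboloids\<close>

lemma Ck_closure_quadratic:
  fixes x p :: "'a::euclidean_space"
  shows "Ck_closure 2 (\<lambda>z. a + p \<bullet> (z - x) + c * (norm (z - x))\<^sup>2) N"
proof -
  let ?\<phi> = "\<lambda>z. a + p \<bullet> (z - x) + c * (norm (z - x))\<^sup>2"
  have d1: "(?\<phi> has_derivative (\<lambda>h. p \<bullet> h + 2 * c * ((z - x) \<bullet> h))) (at z)" for z
    unfolding power2_norm_eq_inner
    by (auto intro!: derivative_eq_intros simp: inner_commute algebra_simps)
  have f1: "frechet_derivative ?\<phi> (at z) b = p \<bullet> b + 2 * c * ((z - x) \<bullet> b)" for z b
    using frechet_derivative_at[OF d1[of z]] by metis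
  have d2: "((\<lambda>z. p \<bullet> b + 2 * c * ((z - x) \<bullet> b)) has_derivative (\<lambda>h. 2 * c * (h \<bullet> b))) (at z)" for z b
    by (auto intro!: derivative_eq_intros)
  have f2: "frechet_derivative (\<lambda>z. p \<bullet> b + 2 * c * ((z - x) \<bullet> b)) (at z) b' = 2 * c * (b' \<bullet> b)" for z b b'
    using frechet_derivative_at[OF d2[of b z]] by metis
  have diff: "?\<phi> differentiable (at z)" "(\<lambda>z. p \<bullet> b + 2 * c * ((z - x) \<bullet> b)) differentiable (at z)" for z b
    using d1 d2 unfolding differentiable_def by blast+
  have "Ck_closure 0 (\<lambda>z. 2 * c * (b' \<bullet> b)) N" for b b' :: 'a
    by (auto intro!: exI[of _ "\<lambda>z. 2 * c * (b' \<bullet> b)"])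
  then have "Ck_closure 1 (\<lambda>z. p \<bullet> b + 2 * c * ((z - x) \<bullet> b)) N" for b
    using diff(2) by (auto simp: f2
        intro!: exI[of _ "\<lambda>z. p \<bullet> b + 2 * c * ((z - x) \<bullet> b)"] continuous_intros)
  then have "Ck_closure (Suc 1) ?\<phi> N"
    using diff(1) by (auto simp: f1
        intro!: exI[of _ ?\<phi>] continuous_intros)
  then show ?thesis by (simp only: Suc_1)
qed

lemma visc_ge_quad_patch:
  assumes "visc_ge LL \<Omega> u f" "x \<in> \<Omega>" "0 < \<delta>" "ball x \<delta> \<subseteq> \<Omega>"
    and "\<And>z. z \<in> ball x \<delta> \<Longrightarrow> z \<noteq> x \<Longrightarrow> u z < u x + p \<bullet> (z - x) + c * (norm (z - x))\<^sup>2"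
  shows "f x \<le> sup_op LL (quad_patch u x p c \<delta>) x"
  unfolding quad_patch_def
  by (rule assms(1)[unfolded visc_ge_def, rule_format]) (use assms(2-) Ck_closure_quadratic in auto)

lemma visc_le_quad_patch:
  assumes "visc_le LL \<Omega> u f" "x \<in> \<Omega>" "0 < \<delta>" "ball x \<delta> \<subseteq> \<Omega>"
    and "\<And>z. z \<in> ball x \<delta> \<Longrightarrow> z \<noteq> x \<Longrightarrow> u x + p \<bullet> (z - x) + c * (norm (z - x))\<^sup>2 < u z"
  shows "sup_op LL (quad_patch u x p c \<delta>) x \<le> f x"
  unfolding quad_patch_def
  by (rule assms(1)[unfolded visc_le_def, rule_format]) (use assms(2-) Ck_closure_quadratic in auto)

text \<open>The information that the two viscosity inequalities give jointly: whenever paraboloids touch \<open>U\<close>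
  from above at \<open>x\<close> and \<open>\<Psi>\<close> from below at \<open>y\<close>, one and the same kernel satisfies both inequalities, up
  to an error \<open>\<eta>\<close>. It serves as a common form of the hypotheses on a supremum and on an infimum of
  operators.\<close>

definition common_kernel ::
  "real \<Rightarrow> real \<Rightarrow> real \<Rightarrow> 'a::euclidean_space set \<Rightarrow> ('a \<Rightarrow> real) \<Rightarrow> ('a \<Rightarrow> real) \<Rightarrow> real \<Rightarrow> real \<Rightarrow> bool" where
  "common_kernel s lam Lam \<Omega> U \<Psi> \<mu> \<mu>' \<longleftrightarrow>
    (\<forall>x\<in>\<Omega>. \<forall>y\<in>\<Omega>. \<forall>p p' c c' \<delta> \<eta>.
       0 < \<delta> \<and> \<delta> \<le> 1 \<and> ball x \<delta> \<subseteq> \<Omega> \<and> ball y \<delta> \<subseteq> \<Omega> \<and> 0 < \<eta> \<and>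
       (\<forall>z\<in>ball x \<delta> - {x}. U z < U x + p \<bullet> (z - x) + c * (norm (z - x))\<^sup>2) \<and>
       (\<forall>z\<in>ball y \<delta> - {y}. \<Psi> y + p' \<bullet> (z - y) + c' * (norm (z - y))\<^sup>2 < \<Psi> z) \<longrightarrow>
       (\<exists>k. admissible_kernel lam Lam k \<and>
          - \<mu> * U x - \<eta> \<le> levy_op s k (quad_patch U x p c \<delta>) x \<and>
          levy_op s k (quad_patch \<Psi> y p' c' \<delta>) y \<le> - \<mu>' * \<Psi> y + \<eta>))"

lemma sup_op_attained:
  assumes "LL \<noteq> {}" "0 < \<eta>" "c \<le> sup_op LL u x"
  shows "\<exists>L\<in>LL. c - \<eta> \<le> L u x"
proof (rule ccontr)
  assume "\<not> ?thesis"
  then have "sup_op LL u x \<le> c - \<eta>"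
    unfolding sup_op_def using assms(1) by (intro cSUP_least) auto
  with assms show False by simp
qed

lemma sup_op_quad_patch_upper:
  fixes u :: "'a::euclidean_space \<Rightarrow> real"
  assumes u: "continuous_on UNIV u" "u \<in> L1_weight s" and s: "0 < s" "s < 1" and \<delta>: "0 < \<delta>" "\<delta> \<le> 1"
    and lam: "0 < lam" and LL: "LL \<subseteq> L_star s lam Lam" "L \<in> LL"
  shows "L (quad_patch u x p c \<delta>) x \<le> sup_op LL (quad_patch u x p c \<delta>) x"
  unfolding sup_op_def
proof (rule cSUP_upper[OF LL(2)])
  let ?B = "Lam / 2 * (LINT z|lborel. \<bar>second_diff (quad_patch u x p c \<delta>) x z / norm z powr (real DIM('a) + 2 * s)\<bar>)"
  show "bdd_above ((\<lambda>L. L (quad_patch u x p c \<delta>) x) ` LL)"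
  proof (rule bdd_aboveI2)
    fix L assume "L \<in> LL"
    then obtain k where "L = levy_op s k" and k: "admissible_kernel lam Lam k"
      using LL(1) by (auto simp: L_star_def)
    then show "L (quad_patch u x p c \<delta>) x \<le> ?B"
      using levy_quad_patch_bound[OF u s \<delta> k lam, of x p c] by simp
  qed
qed

text \<open>For a supremum, the subsolution yields a nearly optimal kernel, and the supersolution inequality
  holds for every kernel.\<close>

lemma common_kernel_sup:
  fixes LL :: "(('a::euclidean_space \<Rightarrow> real) \<Rightarrow> 'a \<Rightarrow> real) set"
  assumes s: "0 < s" "s < 1" and lam: "0 < lam" and LL: "LL \<subseteq> L_star s lam Lam" "LL \<noteq> {}"
    and u: "visc_ge LL \<Omega> u (\<lambda>x. - \<mu> * u x)"
    and \<psi>: "continuous_on UNIV \<psi>" "\<psi> \<in> L1_weight s" "visc_le LL \<Omega> \<psi> (\<lambda>x. - \<mu>' * \<psi> x)"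
  shows "common_kernel s lam Lam \<Omega> u \<psi> \<mu> \<mu>'"
  unfolding common_kernel_def
proof (intro ballI allI impI, elim conjE)
  fix x y p p' :: 'a and c c' \<delta> \<eta> :: real
  assume xy: "x \<in> \<Omega>" "y \<in> \<Omega>" and \<delta>: "0 < \<delta>" "\<delta> \<le> 1" and balls: "ball x \<delta> \<subseteq> \<Omega>" "ball y \<delta> \<subseteq> \<Omega>"
    and \<eta>: "0 < \<eta>"
    and tu: "\<forall>z\<in>ball x \<delta> - {x}. u z < u x + p \<bullet> (z - x) + c * (norm (z - x))\<^sup>2"
    and t\<psi>: "\<forall>z\<in>ball y \<delta> - {y}. \<psi> y + p' \<bullet> (z - y) + c' * (norm (z - y))\<^sup>2 < \<psi> z"
  have "- \<mu> * u x \<le> sup_op LL (quad_patch u x p c \<delta>) x"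
    by (rule visc_ge_quad_patch[OF u xy(1) \<delta>(1) balls(1)]) (use tu in auto)
  then obtain L where L: "L \<in> LL" "- \<mu> * u x - \<eta> \<le> L (quad_patch u x p c \<delta>) x"
    using sup_op_attained[OF LL(2) \<eta>] by blast
  have "L (quad_patch \<psi> y p' c' \<delta>) y \<le> sup_op LL (quad_patch \<psi> y p' c' \<delta>) y"
    by (rule sup_op_quad_patch_upper[OF \<psi>(1,2) s \<delta> lam LL(1) L(1)])
  also have "\<dots> \<le> - \<mu>' * \<psi> y"
    by (rule visc_le_quad_patch[OF \<psi>(3) xy(2) \<delta>(1) balls(2)]) (use t\<psi> in auto)
  finally have "L (quad_patch \<psi> y p' c' \<delta>) y \<le> - \<mu>' * \<psi> y + \<eta>" using \<eta> by linarith
  moreover obtain k where "L = levy_op s k" "admissible_kernel lam Lam k"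
    using L(1) LL(1) by (auto simp: L_star_def)
  ultimately show "\<exists>k. admissible_kernel lam Lam k \<and>
          - \<mu> * u x - \<eta> \<le> levy_op s k (quad_patch u x p c \<delta>) x \<and>
          levy_op s k (quad_patch \<psi> y p' c' \<delta>) y \<le> - \<mu>' * \<psi> y + \<eta>"
    using L(2) by blast
qed

lemma quad_patch_uminus: "quad_patch (\<lambda>z. - u z) x p c \<delta> = (\<lambda>z. - quad_patch u x (- p) (- c) \<delta> z)"
  by (auto simp: quad_patch_def)

lemma levy_op_uminus: "levy_op s k (\<lambda>z. - u z) x = - levy_op s k u x"
proof -
  have "(- u (x + y) + - u (x - y) - 2 * - u x) * w = - ((u (x + y) + u (x - y) - 2 * u x) * w)" for y w
    by (simp add: algebra_simps)
  then show ?thesis unfolding levy_op_def by simp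
qed

text \<open>After the change of sign the supremum becomes an infimum, and the roles are exchanged: the
  nearly optimal kernel comes from \<open>\<psi>\<close>, and the inequality for \<open>u\<close> holds for every kernel.\<close>

lemma common_kernel_inf:
  fixes LL :: "(('a::euclidean_space \<Rightarrow> real) \<Rightarrow> 'a \<Rightarrow> real) set"
  assumes s: "0 < s" "s < 1" and lam: "0 < lam" and LL: "LL \<subseteq> L_star s lam Lam" "LL \<noteq> {}"
    and u: "continuous_on UNIV u" "u \<in> L1_weight s" "visc_le LL \<Omega> u (\<lambda>x. - \<mu> * u x)"
    and \<psi>: "visc_ge LL \<Omega> \<psi> (\<lambda>x. - \<mu>' * \<psi> x)"
  shows "common_kernel s lam Lam \<Omega> (\<lambda>x. - u x) (\<lambda>x. - \<psi> x) \<mu> \<mu>'"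
  unfolding common_kernel_def
proof (intro ballI allI impI, elim conjE)
  fix x y p p' :: 'a and c c' \<delta> \<eta> :: real
  assume xy: "x \<in> \<Omega>" "y \<in> \<Omega>" and \<delta>: "0 < \<delta>" "\<delta> \<le> 1" and balls: "ball x \<delta> \<subseteq> \<Omega>" "ball y \<delta> \<subseteq> \<Omega>"
    and \<eta>: "0 < \<eta>"
    and tu: "\<forall>z\<in>ball x \<delta> - {x}. - u z < - u x + p \<bullet> (z - x) + c * (norm (z - x))\<^sup>2"
    and t\<psi>: "\<forall>z\<in>ball y \<delta> - {y}. - \<psi> y + p' \<bullet> (z - y) + c' * (norm (z - y))\<^sup>2 < - \<psi> z"
  have "- \<mu>' * \<psi> y \<le> sup_op LL (quad_patch \<psi> y (- p') (- c') \<delta>) y"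
    by (rule visc_ge_quad_patch[OF \<psi> xy(2) \<delta>(1) balls(2)]) (use t\<psi> in force)
  then obtain L where L: "L \<in> LL" "- \<mu>' * \<psi> y - \<eta> \<le> L (quad_patch \<psi> y (- p') (- c') \<delta>) y"
    using sup_op_attained[OF LL(2) \<eta>] by blast
  have "L (quad_patch u x (- p) (- c) \<delta>) x \<le> sup_op LL (quad_patch u x (- p) (- c) \<delta>) x"
    by (rule sup_op_quad_patch_upper[OF u(1,2) s \<delta> lam LL(1) L(1)])
  also have "\<dots> \<le> - \<mu> * u x"
    by (rule visc_le_quad_patch[OF u(3) xy(1) \<delta>(1) balls(1)]) (use tu in force)
  finally have "L (quad_patch u x (- p) (- c) \<delta>) x \<le> - \<mu> * u x + \<eta>" using \<eta> by linarith
  moreover obtain k where "L = levy_op s k" "admissible_kernel lam Lam k"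
    using L(1) LL(1) by (auto simp: L_star_def)
  ultimately show "\<exists>k. admissible_kernel lam Lam k \<and>
          - \<mu> * - u x - \<eta> \<le> levy_op s k (quad_patch (\<lambda>x. - u x) x p c \<delta>) x \<and>
          levy_op s k (quad_patch (\<lambda>x. - \<psi> x) y p' c' \<delta>) y \<le> - \<mu>' * - \<psi> y + \<eta>"
    using L(2) unfolding quad_patch_uminus levy_op_uminus by (intro exI[of _ k]) auto
qed

section \<open>Doubling of variables\<close>

text \<open>The hypothesis on \<open>U (x + z) - t * \<Psi> (y + z)\<close> is what doubling the variables provides at a
  maximum. For \<open>norm z \<ge> \<delta>\<close> it makes the difference of the integrands nonpositive, and at most
  \<open>- m\<close> times the kernel for each of \<open>x + z\<close>, \<open>x - z\<close> in \<open>E\<close>; the kernel is at least \<open>lam * r powr (- P)\<close>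
  on \<open>ball 0 r\<close>, where \<open>P = d + 2s\<close>. For \<open>norm z < \<delta>\<close> only the quadratic terms remain. They are of size
  \<open>norm z powr (2 - P)\<close>, split as \<open>norm z powr (1 - s)\<close>, which is at most \<open>\<delta> powr (1 - s)\<close>, times the power
  \<open>1 - s - d\<close>, which is still integrable at the origin.\<close>

lemma levy_op_quad_patch_difference:
  fixes U \<Psi> :: "'a::euclidean_space \<Rightarrow> real"
  assumes s: "0 < s" "s < 1" and lam: "0 < lam" and k: "admissible_kernel lam Lam k"
    and U: "continuous_on UNIV U" "U \<in> L1_weight s"
    and \<Psi>: "continuous_on UNIV \<Psi>" "\<Psi> \<in> L1_weight s"
    and \<delta>: "0 < \<delta>" "\<delta> \<le> 1" and t: "0 < t" and c: "0 \<le> c + t * c'"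
    and m: "m = U x - t * \<Psi> y" "0 \<le> m" and max: "\<And>z. U (x + z) - t * \<Psi> (y + z) \<le> m"
    and E: "E \<in> sets borel" "\<And>z. x + z \<in> E \<Longrightarrow> U (x + z) \<le> t * \<Psi> (y + z)" and r: "0 < r"
  defines "P \<equiv> real DIM('a) + 2 * s"
  defines "J \<equiv> LINT z|lborel. indicator (ball (0::'a) 1) z * norm z powr (1 - s - real DIM('a))"
  shows "levy_op s k (quad_patch U x p c \<delta>) x - t * levy_op s k (quad_patch \<Psi> y p' (- c') \<delta>) y
    \<le> Lam * (c + t * c') * \<delta> powr (1 - s) * J
      - lam * m * r powr (- P) * (measure lborel (E \<inter> ball x r) - measure lborel (ball x \<delta>))"
proof -
  define f where "f = (\<lambda>z. second_diff (quad_patch U x p c \<delta>) x z * (k (sgn z) / norm z powr P))"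
  define g where "g = (\<lambda>z. second_diff (quad_patch \<Psi> y p' (- c') \<delta>) y z * (k (sgn z) / norm z powr P))"
  define h where "h = (\<lambda>z::'a. indicator (ball 0 1) z * norm z powr (1 - s - real DIM('a)))"
  define B where "B = E \<inter> ball x r - ball x \<delta>"
  define i where "i = (indicator B :: 'a \<Rightarrow> real)"
  define H where "H = Lam * (c + t * c') * \<delta> powr (1 - s)"
  define G where "G = lam * m * r powr (- P)"
  have f: "integrable lborel f" unfolding f_def P_def
    by (rule integrable_levy_quad_patch[OF U s \<delta> k lam])
  have g: "integrable lborel g" unfolding g_def P_def
    by (rule integrable_levy_quad_patch[OF \<Psi> s \<delta> k lam])
  have h: "integrable lborel h" unfolding h_def
    using s by (intro integrable_norm_powr_ball) simp
  have B: "B \<in> sets borel" using E(1) by (auto simp: B_def)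
  have Bfin: "emeasure lborel B < \<infinity>"
    using emeasure_mono[of B "ball x r" lborel] emeasure_lborel_ball_finite[of x r]
    by (auto simp: B_def intro: le_less_trans)
  have i: "integrable lborel i" unfolding i_def
    using B Bfin by (intro integrable_real_indicator) auto
  have i1: "integrable lborel (\<lambda>z. i (x + 1 *\<^sub>R z))" and i2: "integrable lborel (\<lambda>z. i (x + (-1) *\<^sub>R z))"
    by (intro integrable_lborel_isometry i; simp)+
  have im: "i \<in> borel_measurable borel" using i by auto
  have Ii: "(LINT z|lborel. i z) = measure lborel B" by (simp add: i_def)
  have I1: "(LINT z|lborel. i (x + 1 *\<^sub>R z)) = measure lborel B"
    and I2: "(LINT z|lborel. i (x + (-1) *\<^sub>R z)) = measure lborel B"
    by (subst integral_lborel_isometry[OF im]; simp add: Ii)+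
  have point: "f z - t * g z \<le> 2 * H * h z - G * (i (x + 1 *\<^sub>R z) + i (x + (-1) *\<^sub>R z))" for z
  proof (cases "z = 0")
    case True
    then show ?thesis
      using \<delta> by (simp add: f_def g_def h_def second_diff_def i_def B_def)
  next
    case nz: False
    note kb = admissible_kernel_bounds[OF k nz]
    have nz': "0 < norm z" using nz by simp
    show ?thesis
    proof (cases "norm z < \<delta>")
      case True
      have "f z - t * g z = 2 * (c + t * c') * k (sgn z) * ((norm z)\<^sup>2 / norm z powr P)"
        using True \<delta> by (simp add: f_def g_def second_diff_quad_patch algebra_simps add_divide_distrib)
      also have "(norm z)\<^sup>2 / norm z powr P = norm z powr (1 - s) * norm z powr (1 - s - real DIM('a))"
        by (simp add: sq_div_powr powr_add[symmetric] P_def algebra_simps)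
      also have "2 * (c + t * c') * k (sgn z) * (norm z powr (1 - s) * norm z powr (1 - s - real DIM('a)))
          \<le> 2 * (c + t * c') * Lam * (\<delta> powr (1 - s) * norm z powr (1 - s - real DIM('a)))"
        proof (rule mult_mono[OF mult_left_mono[OF kb(2)]])
          have "norm z powr (1 - s) \<le> \<delta> powr (1 - s)"
            using True s by (intro powr_mono2) auto
          then show "norm z powr (1 - s) * norm z powr (1 - s - real DIM('a))
              \<le> \<delta> powr (1 - s) * norm z powr (1 - s - real DIM('a))"
            by (rule mult_right_mono) simp
        qed (use c kb lam in auto)
      also have "\<dots> = 2 * H * h z"
        using True \<delta> by (simp add: H_def h_def)
      finally show ?thesis using True by (simp add: i_def B_def dist_norm)
    next
      case False
      define D where "D = second_diff U x z - t * second_diff \<Psi> y z"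
      have fg: "f z - t * g z = D * (k (sgn z) / norm z powr P)"
        using False \<delta> by (simp add: f_def g_def D_def second_diff_quad_patch algebra_simps diff_divide_distrib)
      define e where "e = (indicator E :: 'a \<Rightarrow> real)"
      have side: "U (x + w) - t * \<Psi> (y + w) - m \<le> - m * e (x + w)" for w
        using max[of w] E(2)[of w] by (cases "x + w \<in> E") (auto simp: e_def)
      have "D = (U (x + z) - t * \<Psi> (y + z) - m) + (U (x + - z) - t * \<Psi> (y + - z) - m)"
        by (simp add: D_def second_diff_def m(1) algebra_simps)
      also have "\<dots> \<le> - m * e (x + z) + - m * e (x + - z)"
        by (intro add_mono side)
      finally have D: "D \<le> - m * (e (x + z) + e (x - z))" by (simp add: algebra_simps)
      have e0: "0 \<le> e w" for w by (simp add: e_def)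
      have kp: "0 \<le> k (sgn z) / norm z powr P" using kb lam by simp
      have hz: "0 \<le> 2 * H * h z" using c kb lam by (simp add: H_def h_def)
      show ?thesis
      proof (cases "norm z < r")
        case True
        have P0: "0 \<le> P" using s by (simp add: P_def)
        have "norm z powr P \<le> r powr P" using True P0 by (intro powr_mono2) auto
        then have "lam * r powr (- P) \<le> k (sgn z) / norm z powr P"
          using kb lam nz' r by (simp add: powr_minus divide_inverse) (intro mult_mono le_imp_inverse_le, auto)
        then have "m * (e (x + z) + e (x - z)) * (lam * r powr (- P))
            \<le> m * (e (x + z) + e (x - z)) * (k (sgn z) / norm z powr P)"
          using m(2) e0 by (intro mult_left_mono) auto
        moreover have "D * (k (sgn z) / norm z powr P) \<le> - m * (e (x + z) + e (x - z)) * (k (sgn z) / norm z powr P)"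
          by (rule mult_right_mono[OF D kp])
        moreover have "i (x + 1 *\<^sub>R z) = e (x + z)" "i (x + (-1) *\<^sub>R z) = e (x - z)"
          using True False by (auto simp: i_def e_def B_def dist_norm indicator_def)
        ultimately show ?thesis using hz unfolding fg G_def by (simp add: algebra_simps)
      next
        case False
        have "D \<le> 0" using D m(2) e0[of "x + z"] e0[of "x - z"]
          by (smt (verit) mult_nonneg_nonneg mult_minus_left)
        then have "f z - t * g z \<le> 0" unfolding fg using kp by (rule mult_nonpos_nonneg)
        moreover have "i (x + 1 *\<^sub>R z) = 0" "i (x + (-1) *\<^sub>R z) = 0"
          using False by (auto simp: i_def B_def dist_norm)
        ultimately show ?thesis using hz by simp
      qed
    qed
  qed
  have "(LINT z|lborel. f z - t * g z) \<le> (LINT z|lborel. 2 * H * h z - G * (i (x + 1 *\<^sub>R z) + i (x + (-1) *\<^sub>R z)))"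
    using f g h i1 i2 by (intro integral_mono point) auto
  also have "\<dots> = 2 * H * J - G * (2 * measure lborel B)"
    using h i1 i2 I1 I2 by (simp add: J_def h_def)
  finally have 1: "(LINT z|lborel. f z) - t * (LINT z|lborel. g z) \<le> 2 * H * J - G * (2 * measure lborel B)"
    using f g by simp
  have "measure lborel (E \<inter> ball x r) \<le> measure lborel (B \<union> ball x \<delta>)"
  proof (rule measure_mono_fmeasurable)
    have "ball x \<delta> \<in> fmeasurable lborel" "B \<in> fmeasurable lborel"
      using B Bfin emeasure_lborel_ball_finite[of x \<delta>] by (auto intro: fmeasurableI)
    then show "B \<union> ball x \<delta> \<in> fmeasurable lborel" by (rule fmeasurable.Un[rotated])
  qed (use E(1) in \<open>auto simp: B_def\<close>)
  also have "\<dots> \<le> measure lborel B + measure lborel (ball x \<delta>)"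
    using B by (intro measure_Un_le) auto
  finally have 2: "measure lborel (E \<inter> ball x r) - measure lborel (ball x \<delta>) \<le> measure lborel B" by simp
  have "0 \<le> G" using lam m(2) by (simp add: G_def)
  from mult_left_mono[OF 2 this] 1 show ?thesis
    unfolding levy_op_second_diff P_def[symmetric] f_def[symmetric] g_def[symmetric]
      H_def[symmetric] G_def[symmetric] by simp
qed

text \<open>Freezing one variable at the maximum shows that paraboloids of opening \<open>\<kappa>\<close> and \<open>\<kappa> / t\<close> touch \<open>U\<close>
  at \<open>x\<close> and \<open>\<Psi>\<close> at \<open>y\<close>; increasing both openings by \<open>1\<close> makes the contact strict. The claim is the limit
  \<open>\<delta> \<rightarrow> 0\<close>, with \<open>\<kappa>\<close> fixed, of \<open>levy_op_quad_patch_difference\<close>. The left-hand side measures how often the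
  difference is nonpositive near \<open>x\<close>; with \<open>E = {}\<close> it vanishes.\<close>

lemma doubled_maximum_inequality:
  fixes U \<Psi> :: "'a::euclidean_space \<Rightarrow> real"
  assumes s: "0 < s" "s < 1" and lam: "0 < lam"
    and U: "continuous_on UNIV U" "U \<in> L1_weight s"
    and \<Psi>: "continuous_on UNIV \<Psi>" "\<Psi> \<in> L1_weight s"
    and ck: "common_kernel s lam Lam \<Omega> U \<Psi> \<mu> \<mu>'"
    and \<Omega>: "open \<Omega>" "x \<in> \<Omega>" "y \<in> \<Omega>" and t: "0 < t" and \<kappa>: "0 \<le> \<kappa>"
    and max: "\<And>a b. U a - t * \<Psi> b - \<kappa> * (norm (a - b))\<^sup>2 \<le> U x - t * \<Psi> y - \<kappa> * (norm (x - y))\<^sup>2"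
    and pos: "0 \<le> U x - t * \<Psi> y"
    and E: "E \<in> sets borel" "\<And>a. a \<in> E \<Longrightarrow> U a \<le> t * \<Psi> (a + (y - x))" and r: "0 < r"
  shows "lam * (U x - t * \<Psi> y) * r powr (- (real DIM('a) + 2 * s)) * measure lborel (E \<inter> ball x r)
    \<le> \<mu> * U x - \<mu>' * (t * \<Psi> y)"
proof -
  define m where "m = U x - t * \<Psi> y"
  define P where "P = real DIM('a) + 2 * s"
  define J where "J = (LINT z|lborel. indicator (ball (0::'a) 1) z * norm z powr (1 - s - real DIM('a)))"
  define p where "p = (2 * \<kappa>) *\<^sub>R (x - y)"
  define c where "c = \<kappa> + 1"
  define c' where "c' = \<kappa> / t + 1"
  have cc: "0 \<le> c + t * c'" using t \<kappa> by (simp add: c_def c'_def algebra_simps)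
  obtain \<delta>0 where \<delta>0: "0 < \<delta>0" "ball x \<delta>0 \<subseteq> \<Omega>" "ball y \<delta>0 \<subseteq> \<Omega>"
  proof -
    obtain d1 d2 where "0 < d1" "ball x d1 \<subseteq> \<Omega>" "0 < d2" "ball y d2 \<subseteq> \<Omega>"
      using \<Omega> by (meson open_contains_ball)
    then show ?thesis by (intro that[of "min d1 d2"]) auto
  qed
  have tu: "U z < U x + p \<bullet> (z - x) + c * (norm (z - x))\<^sup>2" if "z \<noteq> x" for z
  proof -
    have "(norm (z - y))\<^sup>2 - (norm (x - y))\<^sup>2 = 2 * ((x - y) \<bullet> (z - x)) + (norm (z - x))\<^sup>2"
      unfolding power2_norm_eq_inner by (simp add: inner_diff inner_commute algebra_simps)
    from arg_cong[OF this, of "\<lambda>v. \<kappa> * v"] max[of z y]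
    have "U z \<le> U x + p \<bullet> (z - x) + \<kappa> * (norm (z - x))\<^sup>2"
      by (simp add: p_def algebra_simps)
    moreover have "0 < (norm (z - x))\<^sup>2" using that by simp
    moreover have "c * (norm (z - x))\<^sup>2 = \<kappa> * (norm (z - x))\<^sup>2 + (norm (z - x))\<^sup>2"
      by (simp add: c_def algebra_simps)
    ultimately show ?thesis by linarith
  qed
  have t\<psi>: "\<Psi> y + (p /\<^sub>R t) \<bullet> (z - y) + - c' * (norm (z - y))\<^sup>2 < \<Psi> z" if "z \<noteq> y" for z
  proof -
    have "(norm (x - z))\<^sup>2 - (norm (x - y))\<^sup>2 = - 2 * ((x - y) \<bullet> (z - y)) + (norm (z - y))\<^sup>2"
      unfolding power2_norm_eq_inner by (simp add: inner_diff inner_commute algebra_simps)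
    from arg_cong[OF this, of "\<lambda>v. \<kappa> * v"] max[of x z]
    have "t * \<Psi> y + p \<bullet> (z - y) - \<kappa> * (norm (z - y))\<^sup>2 \<le> t * \<Psi> z"
      by (simp add: p_def algebra_simps)
    moreover have "0 < t * (norm (z - y))\<^sup>2" using that t by simp
    moreover have "t * (\<Psi> y + (p /\<^sub>R t) \<bullet> (z - y) + - c' * (norm (z - y))\<^sup>2)
        = t * \<Psi> y + p \<bullet> (z - y) - \<kappa> * (norm (z - y))\<^sup>2 - t * (norm (z - y))\<^sup>2"
    proof -
      have "t * ((p /\<^sub>R t) \<bullet> (z - y)) = p \<bullet> (z - y)" "t * c' = \<kappa> + t"
        using t by (simp, simp add: c'_def algebra_simps)
      then show ?thesis
        using distrib_right[of \<kappa> t "(norm (z - y))\<^sup>2"]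
        by (simp only: distrib_left mult.assoc[symmetric] mult_minus_right mult_minus_left)
    qed
    ultimately have "t * (\<Psi> y + (p /\<^sub>R t) \<bullet> (z - y) + - c' * (norm (z - y))\<^sup>2) < t * \<Psi> z"
      by linarith
    then show ?thesis using t by simp
  qed
  have est: "lam * m * r powr (- P) * (measure lborel (E \<inter> ball x r) - measure lborel (ball x \<delta>))
      \<le> \<mu> * U x - \<mu>' * (t * \<Psi> y) + \<delta> * (1 + t) + Lam * (c + t * c') * \<delta> powr (1 - s) * J"
    if \<delta>: "0 < \<delta>" "\<delta> < min 1 \<delta>0" for \<delta>
  proof -
    have b: "ball x \<delta> \<subseteq> \<Omega>" "ball y \<delta> \<subseteq> \<Omega>" using \<delta> \<delta>0 by (auto dest!: subsetD)
    \<comment> \<open>The error \<open>\<eta>\<close> is chosen equal to the radius \<open>\<delta>\<close>, so that one limit removes both.\<close>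
    obtain k where k: "admissible_kernel lam Lam k"
      and k1: "- \<mu> * U x - \<delta> \<le> levy_op s k (quad_patch U x p c \<delta>) x"
      and k2: "levy_op s k (quad_patch \<Psi> y (p /\<^sub>R t) (- c') \<delta>) y \<le> - \<mu>' * \<Psi> y + \<delta>"
      using ck[unfolded common_kernel_def, rule_format, OF \<Omega>(2,3), of \<delta> \<delta> p c "p /\<^sub>R t" "- c'"] \<delta> b tu t\<psi>
      by auto
    have "U (x + z) - t * \<Psi> (y + z) \<le> m" for z
      using max[of "x + z" "y + z"] by (simp add: m_def)
    note m_max = this
    have E_shift: "U (x + z) \<le> t * \<Psi> (y + z)" if "x + z \<in> E" for z
      using E(2)[OF that] by (simp add: algebra_simps)
    have \<delta>1: "\<delta> \<le> 1" and m0: "0 \<le> m" using \<delta> pos by (auto simp: m_def)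
    have "levy_op s k (quad_patch U x p c \<delta>) x - t * levy_op s k (quad_patch \<Psi> y (p /\<^sub>R t) (- c') \<delta>) y
      \<le> Lam * (c + t * c') * \<delta> powr (1 - s) * J
        - lam * m * r powr (- P) * (measure lborel (E \<inter> ball x r) - measure lborel (ball x \<delta>))"
      unfolding P_def J_def
      by (rule levy_op_quad_patch_difference[OF s lam k U \<Psi> \<delta>(1) \<delta>1 t cc m_def m0 m_max E(1) E_shift r])
    moreover have "t * levy_op s k (quad_patch \<Psi> y (p /\<^sub>R t) (- c') \<delta>) y \<le> t * (- \<mu>' * \<Psi> y + \<delta>)"
      using k2 t by (intro mult_left_mono) auto
    ultimately show ?thesis using k1 by (simp add: algebra_simps)
  qed
  have "((\<lambda>\<delta>. lam * m * r powr (- P) * (measure lborel (E \<inter> ball x r) - unit_ball_vol DIM('a) * \<delta> ^ DIM('a)))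
      \<longlongrightarrow> lam * m * r powr (- P) * (measure lborel (E \<inter> ball x r) - unit_ball_vol DIM('a) * 0 ^ DIM('a))) (at_right 0)"
    by (intro tendsto_intros)
  moreover have "((\<lambda>\<delta>. \<mu> * U x - \<mu>' * (t * \<Psi> y) + \<delta> * (1 + t) + Lam * (c + t * c') * \<delta> powr (1 - s) * J)
      \<longlongrightarrow> \<mu> * U x - \<mu>' * (t * \<Psi> y) + 0 * (1 + t) + Lam * (c + t * c') * 0 * J) (at_right 0)"
  proof (intro tendsto_intros)
    show "((\<lambda>\<delta>. \<delta> powr (1 - s)) \<longlongrightarrow> 0) (at_right (0::real))"
      using s by real_asymp
  qed
  moreover have "\<forall>\<^sub>F \<delta> in at_right 0. lam * m * r powr (- P) * (measure lborel (E \<inter> ball x r) - unit_ball_vol DIM('a) * \<delta> ^ DIM('a))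
      \<le> \<mu> * U x - \<mu>' * (t * \<Psi> y) + \<delta> * (1 + t) + Lam * (c + t * c') * \<delta> powr (1 - s) * J"
  proof (rule eventually_mono)
    show "\<forall>\<^sub>F \<delta> in at_right 0. \<delta> \<in> {0<..<min 1 \<delta>0}"
      using \<delta>0(1) by (intro eventually_at_right_real) simp
    fix \<delta> :: real assume "\<delta> \<in> {0<..<min 1 \<delta>0}"
    with est[of \<delta>] show "lam * m * r powr (- P) * (measure lborel (E \<inter> ball x r) - unit_ball_vol DIM('a) * \<delta> ^ DIM('a))
      \<le> \<mu> * U x - \<mu>' * (t * \<Psi> y) + \<delta> * (1 + t) + Lam * (c + t * c') * \<delta> powr (1 - s) * J"
      by (simp add: content_ball)
  qed
  ultimately have "lam * m * r powr (- P) * (measure lborel (E \<inter> ball x r) - unit_ball_vol DIM('a) * 0 ^ DIM('a))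
     \<le> \<mu> * U x - \<mu>' * (t * \<Psi> y) + 0 * (1 + t) + Lam * (c + t * c') * 0 * J"
    by (intro tendsto_le[rotated 2]) (auto simp: trivial_limit_at_right_real)
  then show ?thesis by (simp add: m_def P_def zero_power)
qed

text \<open>Uniform continuity on \<open>K\<close> with only one of the two points in \<open>K\<close>; the other one lies in a compact
  neighbourhood of \<open>K\<close>.\<close>

lemma uniform_nbhd:
  fixes \<Psi> :: "'a::euclidean_space \<Rightarrow> real"
  assumes "continuous_on UNIV \<Psi>" "compact K" "0 < e"
  shows "\<exists>\<tau>>0. \<forall>a\<in>K. \<forall>b. dist a b < \<tau> \<longrightarrow> \<bar>\<Psi> a - \<Psi> b\<bar> < e"
proof -
  define K' where "K' = {a + v | a v. a \<in> K \<and> v \<in> cball 0 1}"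
  have "compact K'" unfolding K'_def using assms(2) by (intro compact_sums) auto
  then have "uniformly_continuous_on K' \<Psi>"
    using assms(1) by (intro compact_uniformly_continuous) (auto intro: continuous_on_subset)
  then obtain d where d: "0 < d" "\<And>a b. a \<in> K' \<Longrightarrow> b \<in> K' \<Longrightarrow> dist b a < d \<Longrightarrow> dist (\<Psi> b) (\<Psi> a) < e"
    using assms(3) unfolding uniformly_continuous_on_def by meson
  show ?thesis
  proof (intro exI[of _ "min d 1"] conjI ballI allI impI)
    fix a b assume ab: "a \<in> K" "dist a b < min d 1"
    have "a \<in> K'" unfolding K'_def using ab(1) by (intro CollectI exI[of _ a] exI[of _ 0]) auto
    moreover have "b \<in> K'" unfolding K'_def using ab
      by (intro CollectI exI[of _ a] exI[of _ "b - a"]) (auto simp: dist_norm norm_minus_commute)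
    ultimately show "\<bar>\<Psi> a - \<Psi> b\<bar> < e" using d(2)[of b a] ab(2) by (simp add: dist_real_def)
  qed (use d in auto)
qed

text \<open>Let \<open>m\<close> be the value of \<open>U - t \<Psi>\<close> at \<open>x0\<close>. As \<open>\<Psi> \<ge> 0\<close>, pairs \<open>(a, b)\<close> at which the penalized
  difference is at least \<open>m\<close> have \<open>a\<close> in the set \<open>U \<ge> m\<close>, which is a compact subset of \<open>\<Omega>\<close> as
  \<open>U \<le> 0\<close> outside, and the penalty confines \<open>b\<close> to a small neighbourhood. Thus a global maximum exists
  although \<open>U\<close> and \<open>\<Psi>\<close> need not be bounded, and both of its points lie in \<open>\<Omega>\<close>.\<close>

lemma doubled_maximum_exists:
  fixes U \<Psi> :: "'a::euclidean_space \<Rightarrow> real"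
  assumes U: "continuous_on UNIV U" and \<Psi>: "continuous_on UNIV \<Psi>" "\<And>x. 0 \<le> \<Psi> x"
    and \<Omega>: "open \<Omega>" "bounded \<Omega>" and out: "\<And>x. x \<notin> \<Omega> \<Longrightarrow> U x \<le> 0"
    and t: "0 \<le> t" and x0: "t * \<Psi> x0 < U x0" and \<tau>: "0 < \<tau>"
  obtains x y \<kappa> where "x \<in> \<Omega>" "y \<in> \<Omega>" "dist x y < \<tau>" "0 < \<kappa>"
    "\<And>a b. U a - t * \<Psi> b - \<kappa> * (norm (a - b))\<^sup>2 \<le> U x - t * \<Psi> y - \<kappa> * (norm (x - y))\<^sup>2"
    "U x0 - t * \<Psi> x0 \<le> U x - t * \<Psi> y"
proof -
  define m where "m = U x0 - t * \<Psi> x0"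
  have m: "0 < m" using x0 by (simp add: m_def)
  define C where "C = closure \<Omega> \<inter> {x. m \<le> U x}"
  have Cc: "compact C" unfolding C_def
    using \<Omega>(2) U by (intro compact_Int_closed) (auto simp: compact_closure intro!: closed_Collect_le continuous_intros)
  have CO: "C \<subseteq> \<Omega>" using out m by (force simp: C_def)
  have C: "a \<in> C" if "m \<le> U a" for a
    using that out[of a] m closure_subset[of \<Omega>] by (force simp: C_def)
  have tp: "0 \<le> t * \<Psi> z" for z using t \<Psi>(2) by simp
  have x0C: "x0 \<in> C" using tp[of x0] by (intro C) (simp add: m_def)
  obtain d0 where d0: "0 < d0" "(\<Union>a\<in>C. ball a d0) \<subseteq> \<Omega>"
    using compact_subset_open_imp_ball_epsilon_subset[OF Cc \<Omega>(1) CO] by blast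
  obtain M where M: "\<And>a. a \<in> C \<Longrightarrow> U a \<le> M" "0 < M"
  proof -
    obtain q where "q \<in> C" "\<And>a. a \<in> C \<Longrightarrow> U a \<le> U q"
      using continuous_attains_sup[OF Cc, of U] x0C U by (auto intro: continuous_on_subset)
    then show ?thesis using x0C m by (intro that[of "U q"]) (auto simp: C_def)
  qed
  define e where "e = min 1 (min \<tau> d0)"
  have e: "0 < e" "e \<le> 1" "e \<le> \<tau>" "e \<le> d0" using \<tau> d0 by (auto simp: e_def)
  \<comment> \<open>Then \<open>\<kappa> * (norm (a - b))\<^sup>2 < M\<close>, with \<open>M\<close> an upper bound of \<open>U\<close>, forces \<open>norm (a - b) < e\<close>.\<close>
  define \<kappa> where "\<kappa> = M / e\<^sup>2"
  have \<kappa>: "0 < \<kappa>" using M e by (simp add: \<kappa>_def)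
  define F where "F = (\<lambda>(a, b). U a - t * \<Psi> b - \<kappa> * (norm (a - b))\<^sup>2)"
  have near: "a \<in> C" "dist a b < e" if "m \<le> F (a, b)" for a b
  proof -
    have "0 \<le> \<kappa> * (norm (a - b))\<^sup>2" using \<kappa> by simp
    then show a: "a \<in> C" using that tp[of b] by (intro C) (simp add: F_def)
    have "\<kappa> * (norm (a - b))\<^sup>2 < M" using that tp[of b] M(1)[OF a] m by (simp add: F_def)
    then have "(norm (a - b))\<^sup>2 < e\<^sup>2" using M e by (simp add: \<kappa>_def field_simps)
    then show "dist a b < e" using e by (simp add: dist_norm power_less_imp_less_base)
  qed
  define S where "S = C \<times> {a + v | a v. a \<in> C \<and> v \<in> cball 0 1}"
  have "compact S" unfolding S_def using Cc by (intro compact_Times compact_sums) auto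
  moreover have Sin: "(a, b) \<in> S" if "m \<le> F (a, b)" for a b
  proof -
    have "b = a + (b - a)" "b - a \<in> cball 0 1"
      using near(2)[OF that] e by (auto simp: dist_norm norm_minus_commute)
    then show ?thesis using near(1)[OF that] unfolding S_def by blast
  qed
  have x0S: "(x0, x0) \<in> S" by (rule Sin) (simp add: F_def m_def)
  moreover have "continuous_on S F" unfolding F_def case_prod_beta
    by (intro continuous_intros continuous_on_compose2[OF U] continuous_on_compose2[OF \<Psi>(1)]) auto
  ultimately obtain w where w: "w \<in> S" "\<And>v. v \<in> S \<Longrightarrow> F v \<le> F w"
    using continuous_attains_sup[of S F] by blast
  obtain x y where xy: "w = (x, y)" by fastforce
  have Fm: "m \<le> F (x, y)" using w(2)[OF x0S] by (simp add: xy F_def m_def)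
  show ?thesis
  proof (rule that[of x y \<kappa>])
    show "x \<in> \<Omega>" using near(1)[OF Fm] CO by blast
    show "y \<in> \<Omega>" using near[OF Fm] d0(2) e by force
    show "dist x y < \<tau>" using near(2)[OF Fm] e by simp
    show "U a - t * \<Psi> b - \<kappa> * (norm (a - b))\<^sup>2 \<le> U x - t * \<Psi> y - \<kappa> * (norm (x - y))\<^sup>2" for a b
    proof (cases "m \<le> F (a, b)")
      case True
      from w(2)[OF Sin[OF True]] show ?thesis by (simp add: xy F_def)
    next
      case False
      then show ?thesis using Fm by (simp add: F_def)
    qed
    have "0 \<le> \<kappa> * (norm (x - y))\<^sup>2" using \<kappa> by simp
    then show "U x0 - t * \<Psi> x0 \<le> U x - t * \<Psi> y" using Fm by (simp add: F_def m_def)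
  qed (rule \<kappa>)
qed

section \<open>The maximum principle below the half-eigenvalues\<close>

locale subsolution_supersolution_pair =
  fixes s lam Lam \<mu> \<mu>' :: real and \<Omega> :: "'a::euclidean_space set" and U \<Psi> :: "'a \<Rightarrow> real"
  assumes s: "0 < s" "s < 1" and lam: "0 < lam"
    and \<Omega>: "open \<Omega>" "bounded \<Omega>"
    and U: "continuous_on UNIV U" "U \<in> L1_weight s" and U_outside: "x \<notin> \<Omega> \<Longrightarrow> U x \<le> 0"
    and \<Psi>: "continuous_on UNIV \<Psi>" "\<Psi> \<in> L1_weight s"
    and \<Psi>_nonneg: "0 \<le> \<Psi> x" and \<Psi>_pos: "x \<in> \<Omega> \<Longrightarrow> 0 < \<Psi> x"
    and kernels: "common_kernel s lam Lam \<Omega> U \<Psi> \<mu> \<mu>'"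
    and gap: "\<mu> < \<mu>'"
begin

text \<open>The maximum principle in narrow sets. Apart from a set of at most half the volume of a ball of
  radius \<open>r\<close>, every ball of that radius lies in \<open>E = K \<union> - \<Omega>\<close>, where \<open>U \<le> t \<Psi>\<close>. Hence the nonlocal
  term at a positive maximum is at least of order \<open>r powr (- (2 * s))\<close> times the maximum, and it outweighs
  \<open>\<mu>\<close> once \<open>r\<close> is small.\<close>

lemma some_multiple_dominates: "\<exists>t>0. \<forall>x. U x \<le> t * \<Psi> x"
proof -
  define P where "P = real DIM('a) + 2 * s"
  define v where "v = unit_ball_vol (real DIM('a))"
  have v: "0 < v" by (simp add: v_def)
  \<comment> \<open>\<open>r\<close> is chosen such that \<open>r powr (- (2 * s)) = R\<close>, which makes the nonlocal term large.\<close>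
  define R where "R = max 1 (2 * \<bar>\<mu>\<bar> / (lam * v))"
  define r where "r = R powr (- 1 / (2 * s))"
  have R: "0 < R" "2 * \<bar>\<mu>\<bar> / (lam * v) \<le> R" by (simp_all add: R_def)
  have r: "0 < r" using R by (simp add: r_def)
  have "r powr (- P) * r ^ DIM('a) = r powr (- (2 * s))"
    using r by (simp add: P_def powr_realpow[symmetric] powr_add[symmetric])
  also have "\<dots> = R" using s R by (simp add: r_def powr_powr)
  finally have rR: "r powr (- P) * r ^ DIM('a) = R" .
  define V where "V = v * r ^ DIM('a)"
  have V: "measure lborel (ball x r) = V" for x :: 'a
    using r by (simp add: V_def v_def content_ball)
  have V0: "0 < V" using v r by (simp add: V_def)
  have large: "\<mu> \<le> lam * r powr (- P) * (V / 2)"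
  proof -
    have "\<bar>\<mu>\<bar> \<le> lam * v * R / 2" using R(2) lam v by (simp add: field_simps)
    also have "\<dots> = lam * r powr (- P) * (V / 2)" by (simp add: V_def rR[symmetric])
    finally show ?thesis by simp
  qed
  have "\<Omega> \<in> sets lebesgue" "0 < V / 2"
    using \<Omega>(1) V0 by (auto intro!: sets_completionI_sets)
  then obtain K where K: "closed K" "K \<subseteq> \<Omega>" "\<Omega> - K \<in> lmeasurable"
      "emeasure lebesgue (\<Omega> - K) < ennreal (V / 2)"
    by (rule sets_lebesgue_inner_closed)
  have Kc: "compact K" using K \<Omega>(2) by (meson bounded_subset compact_eq_bounded_closed)
  have [measurable]: "\<Omega> \<in> sets borel" "K \<in> sets borel" using \<Omega>(1) K(1) by auto
  have small: "emeasure lborel (\<Omega> - K) < ennreal (V / 2)"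
    using K(4) by simp
  then have "emeasure lborel (\<Omega> - K) < \<infinity>"
    by (rule less_trans) simp
  then have OK: "\<Omega> - K \<in> fmeasurable lborel"
    by (intro fmeasurableI) simp_all
  have small': "measure lborel (\<Omega> - K) \<le> V / 2"
    unfolding measure_def using small V0 by (intro enn2real_leI) auto
  define E where "E = K \<union> - \<Omega>"
  have E: "E \<in> sets borel" by (simp add: E_def)
  have E_large: "V / 2 \<le> measure lborel (E \<inter> ball x r)" for x
  proof -
    have fin: "E \<inter> ball x r \<in> fmeasurable lborel"
    proof (rule fmeasurableI)
      show "emeasure lborel (E \<inter> ball x r) < \<infinity>"
        by (rule le_less_trans[OF emeasure_mono emeasure_lborel_ball_finite[of x r]]) auto
    qed (use E in simp)
    have "measure lborel (ball x r) \<le> measure lborel ((E \<inter> ball x r) \<union> (\<Omega> - K))"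
      using fin OK by (intro measure_mono_fmeasurable fmeasurable.Un) (auto simp: E_def)
    also have "\<dots> \<le> measure lborel (E \<inter> ball x r) + measure lborel (\<Omega> - K)"
      using E by (intro measure_Un_le) auto
    finally show ?thesis using small' V[of x] by simp
  qed
  \<comment> \<open>The margin \<open>1\<close> leaves room for evaluating \<open>U\<close> and \<open>\<Psi>\<close> at two different, close points.\<close>
  obtain t where t: "0 < t" "\<And>a. a \<in> K \<Longrightarrow> U a + 1 \<le> t * \<Psi> a"
  proof -
    have "continuous_on K (\<lambda>a. (U a + 1) / \<Psi> a)"
      using U(1) \<Psi>(1) K(2) \<Psi>_pos
      by (intro continuous_intros) (auto intro: continuous_on_subset simp: less_imp_neq[symmetric])
    then have "bounded ((\<lambda>a. (U a + 1) / \<Psi> a) ` K)"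
      using Kc by (intro compact_imp_bounded compact_continuous_image)
    then obtain B where B: "\<And>a. a \<in> K \<Longrightarrow> \<bar>(U a + 1) / \<Psi> a\<bar> \<le> B"
      by (auto simp: bounded_iff)
    show ?thesis
    proof (rule that[of "max 1 B"])
      fix a assume a: "a \<in> K"
      then have "0 < \<Psi> a" using K(2) \<Psi>_pos by blast
      moreover have "(U a + 1) / \<Psi> a \<le> max 1 B" using B[OF a] by linarith
      ultimately show "U a + 1 \<le> max 1 B * \<Psi> a" by (simp add: pos_divide_le_eq)
    qed simp
  qed
  obtain \<tau> where \<tau>: "0 < \<tau>" "\<And>a b. a \<in> K \<Longrightarrow> dist a b < \<tau> \<Longrightarrow> \<bar>\<Psi> a - \<Psi> b\<bar> < 1 / t"
    using uniform_nbhd[OF \<Psi>(1) Kc, of "1 / t"] t(1) by auto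
  have E_below: "U a \<le> t * \<Psi> b" if "a \<in> E" "dist a b < \<tau>" for a b
  proof (cases "a \<in> K")
    case True
    have "t * (\<Psi> a - \<Psi> b) \<le> 1"
      using \<tau>(2)[OF True that(2)] t(1) by (simp add: abs_less_iff field_simps)
    then show ?thesis using t(2)[OF True] by (simp add: algebra_simps)
  next
    case False
    then have "U a \<le> 0" using that(1) U_outside by (simp add: E_def)
    also have "0 \<le> t * \<Psi> b" using t(1) \<Psi>_nonneg by simp
    finally show ?thesis .
  qed
  have "U x0 \<le> t * \<Psi> x0" for x0
  proof (rule ccontr)
    assume "\<not> ?thesis"
    then have x0: "t * \<Psi> x0 < U x0" by simp
    obtain x y \<kappa> where xy: "x \<in> \<Omega>" "y \<in> \<Omega>" "dist x y < \<tau>" and \<kappa>: "0 < \<kappa>"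
      and max: "\<And>a b. U a - t * \<Psi> b - \<kappa> * (norm (a - b))\<^sup>2 \<le> U x - t * \<Psi> y - \<kappa> * (norm (x - y))\<^sup>2"
      and gt: "U x0 - t * \<Psi> x0 \<le> U x - t * \<Psi> y"
      using doubled_maximum_exists[OF U(1) \<Psi>(1) \<Psi>_nonneg \<Omega> U_outside less_imp_le[OF t(1)] x0 \<tau>(1)] by blast
    define m where "m = U x - t * \<Psi> y"
    have m: "0 < m" using gt x0 by (simp add: m_def)
    have "lam * m * r powr (- P) * measure lborel (E \<inter> ball x r) \<le> \<mu> * U x - \<mu>' * (t * \<Psi> y)"
      unfolding m_def P_def
    proof (rule doubled_maximum_inequality[OF s lam U \<Psi> kernels \<Omega>(1) xy(1,2) t(1) _ max _ E _ r])
      show "U a \<le> t * \<Psi> (a + (y - x))" if "a \<in> E" for a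
        using E_below[OF that, of "a + (y - x)"] xy(3) by (simp add: dist_norm)
    qed (use \<kappa> m in \<open>auto simp: m_def\<close>)
    moreover have "lam * m * r powr (- P) * (V / 2) \<le> lam * m * r powr (- P) * measure lborel (E \<inter> ball x r)"
      using E_large[of x] lam m by (intro mult_left_mono) auto
    moreover have "\<mu> * m \<le> lam * m * r powr (- P) * (V / 2)"
      using mult_right_mono[OF large less_imp_le[OF m]] by (simp add: mult_ac)
    ultimately have "\<mu> * m \<le> \<mu> * U x - \<mu>' * (t * \<Psi> y)" by linarith
    then have "(\<mu>' - \<mu>) * (t * \<Psi> y) \<le> 0" by (simp add: m_def algebra_simps)
    moreover have "0 < (\<mu>' - \<mu>) * (t * \<Psi> y)" using gap t(1) \<Psi>_pos[OF xy(2)] by simp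
    ultimately show False by linarith
  qed
  with t(1) show ?thesis by blast
qed

text \<open>At a doubled maximum, \<open>U x \<le> t1 * \<Psi> x\<close> and \<open>\<Psi> x \<le> (1 + \<theta>) * \<Psi> y\<close> bound the maximum of \<open>U - t \<Psi>\<close>,
  \<open>t = t1 / (1 + \<theta>)\<close>, by \<open>((1 + \<theta>)\<^sup>2 - 1) * (t * \<Psi> y)\<close>, whereas the equation makes \<open>\<mu>\<close> times the maximum at
  least \<open>(\<mu>' - \<mu>) * (t * \<Psi> y)\<close>. One factor \<open>1 + \<theta>\<close> is the decrease from \<open>t1\<close> to \<open>t\<close>, the other one pays
  for the distance of \<open>x\<close> and \<open>y\<close>.\<close>

lemma smaller_multiple_dominates:
  assumes \<theta>: "0 < \<theta>" "\<bar>\<mu>\<bar> * (2 * \<theta> + \<theta>\<^sup>2) < \<mu>' - \<mu>"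
    and t1: "0 < t1" "\<And>x. U x \<le> t1 * \<Psi> x"
  shows "U x0 \<le> t1 / (1 + \<theta>) * \<Psi> x0"
proof (rule ccontr)
  define t where "t = t1 / (1 + \<theta>)"
  have t: "0 < t" "t1 = t * (1 + \<theta>)" using \<theta> t1 by (simp_all add: t_def)
  assume "\<not> ?thesis"
  then have x0: "t * \<Psi> x0 < U x0" by (simp add: t_def)
  define m0 where "m0 = U x0 - t * \<Psi> x0"
  have m0: "0 < m0" using x0 by (simp add: m0_def)
  define C where "C = closure \<Omega> \<inter> {x. m0 \<le> U x}"
  have Cc: "compact C" unfolding C_def
    using \<Omega>(2) U(1) by (intro compact_Int_closed) (auto simp: compact_closure intro!: closed_Collect_le continuous_intros)
  have CO: "C \<subseteq> \<Omega>" using U_outside m0 by (force simp: C_def)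
  obtain c0 where c0: "0 < c0" "\<And>a. a \<in> C \<Longrightarrow> c0 \<le> \<Psi> a"
  proof (cases "C = {}")
    case False
    then obtain q where "q \<in> C" "\<And>a. a \<in> C \<Longrightarrow> \<Psi> q \<le> \<Psi> a"
      using continuous_attains_inf[OF Cc, of \<Psi>] \<Psi>(1) by (auto intro: continuous_on_subset)
    then show ?thesis using that[of "\<Psi> q"] \<Psi>_pos CO by blast
  qed (use that[of 1] in auto)
  \<comment> \<open>A variation of \<open>\<Psi>\<close> below \<open>e\<close> turns \<open>\<Psi> x \<ge> c0\<close> into \<open>\<Psi> x \<le> (1 + \<theta>) * \<Psi> y\<close>.\<close>
  define e where "e = \<theta> * c0 / (1 + \<theta>)"
  have e: "0 < e" using \<theta> c0 by (simp add: e_def)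
  obtain \<tau> where \<tau>: "0 < \<tau>" "\<And>a b. a \<in> C \<Longrightarrow> dist a b < \<tau> \<Longrightarrow> \<bar>\<Psi> a - \<Psi> b\<bar> < e"
    using uniform_nbhd[OF \<Psi>(1) Cc e] by auto
  obtain x y \<kappa> where xy: "x \<in> \<Omega>" "y \<in> \<Omega>" "dist x y < \<tau>" and \<kappa>: "0 < \<kappa>"
    and max: "\<And>a b. U a - t * \<Psi> b - \<kappa> * (norm (a - b))\<^sup>2 \<le> U x - t * \<Psi> y - \<kappa> * (norm (x - y))\<^sup>2"
    and gt: "U x0 - t * \<Psi> x0 \<le> U x - t * \<Psi> y"
    using doubled_maximum_exists[OF U(1) \<Psi>(1) \<Psi>_nonneg \<Omega> U_outside less_imp_le[OF t(1)] x0 \<tau>(1)] by blast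
  define m where "m = U x - t * \<Psi> y"
  define w where "w = t * \<Psi> y"
  have m: "0 < m" using gt x0 by (simp add: m_def)
  have w: "0 < w" using t(1) \<Psi>_pos[OF xy(2)] by (simp add: w_def)
  have "0 \<le> t * \<Psi> y" using t(1) \<Psi>_nonneg by simp
  then have "m0 \<le> U x" using gt by (simp add: m0_def)
  then have xC: "x \<in> C" using xy(1) closure_subset[of \<Omega>] by (auto simp: C_def)
  have "\<Psi> x \<le> (1 + \<theta>) * \<Psi> y"
  proof -
    have "\<Psi> x - \<Psi> y < e" using \<tau>(2)[OF xC xy(3)] by linarith
    moreover have "(1 + \<theta>) * e \<le> \<theta> * \<Psi> x" using c0(2)[OF xC] \<theta> by (simp add: e_def)
    moreover have "(1 + \<theta>) * (\<Psi> x - \<Psi> y) \<le> (1 + \<theta>) * e"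
      using calculation(1) \<theta> by (intro mult_left_mono) auto
    ultimately show ?thesis by (simp add: algebra_simps)
  qed
  then have "t1 * \<Psi> x \<le> t1 * ((1 + \<theta>) * \<Psi> y)" using t1(1) by (intro mult_left_mono) auto
  then have mw: "m \<le> w * (2 * \<theta> + \<theta>\<^sup>2)"
    using t1(2)[of x] by (simp add: m_def w_def t(2) power2_eq_square algebra_simps)
  have "lam * (U x - t * \<Psi> y) * 1 powr (- (real DIM('a) + 2 * s)) * measure lborel ({} \<inter> ball x 1)
      \<le> \<mu> * U x - \<mu>' * (t * \<Psi> y)"
    by (rule doubled_maximum_inequality[OF s lam U \<Psi> kernels \<Omega>(1) xy(1,2) t(1) _ max])
      (use \<kappa> m in \<open>auto simp: m_def\<close>)
  then have "(\<mu>' - \<mu>) * w \<le> \<mu> * m" by (simp add: m_def w_def algebra_simps)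
  also have "\<dots> \<le> \<bar>\<mu>\<bar> * m" using m by (intro mult_right_mono) auto
  also have "\<dots> \<le> \<bar>\<mu>\<bar> * (w * (2 * \<theta> + \<theta>\<^sup>2))" using mw by (intro mult_left_mono) auto
  also have "\<dots> = w * (\<bar>\<mu>\<bar> * (2 * \<theta> + \<theta>\<^sup>2))" by (simp add: mult_ac)
  also have "\<dots> < w * (\<mu>' - \<mu>)" using \<theta>(2) w by (intro mult_strict_left_mono)
  finally show False by (simp add: mult.commute)
qed

lemma subsolution_nonpos: "U x \<le> 0"
proof -
  obtain t where t: "0 < t" "\<And>x. U x \<le> t * \<Psi> x" using some_multiple_dominates by blast
  \<comment> \<open>Then \<open>2 * \<theta> + \<theta>\<^sup>2 \<le> 3 * \<theta>\<close>, since \<open>\<theta> \<le> 1\<close>.\<close>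
  define \<theta> where "\<theta> = min 1 ((\<mu>' - \<mu>) / (3 * \<bar>\<mu>\<bar> + 1))"
  have \<theta>: "0 < \<theta>" "\<theta> \<le> 1" using gap by (simp_all add: \<theta>_def add_nonneg_pos)
  have "\<bar>\<mu>\<bar> * (2 * \<theta> + \<theta>\<^sup>2) \<le> \<bar>\<mu>\<bar> * (3 * \<theta>)"
    using \<theta> by (intro mult_left_mono) (auto simp: power2_eq_square mult_left_le)
  also have "\<dots> < (3 * \<bar>\<mu>\<bar> + 1) * \<theta>" using \<theta> by (simp add: algebra_simps)
  also have "\<dots> \<le> (3 * \<bar>\<mu>\<bar> + 1) * ((\<mu>' - \<mu>) / (3 * \<bar>\<mu>\<bar> + 1))"
    by (intro mult_left_mono) (auto simp: \<theta>_def)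
  also have "\<dots> = \<mu>' - \<mu>"
  proof -
    have "3 * \<bar>\<mu>\<bar> + 1 \<noteq> 0" by linarith
    then show ?thesis by simp
  qed
  finally have small: "\<bar>\<mu>\<bar> * (2 * \<theta> + \<theta>\<^sup>2) < \<mu>' - \<mu>" .
  have iterate: "\<forall>x. U x \<le> t * (1 / (1 + \<theta>)) ^ n * \<Psi> x" for n
  proof (induction n)
    case (Suc n)
    have "0 < t * (1 / (1 + \<theta>)) ^ n" using t \<theta> by simp
    from smaller_multiple_dominates[OF \<theta>(1) small this] Suc show ?case
      by (simp add: mult.assoc)
  qed (use t in simp)
  have "(\<lambda>n. t * (1 / (1 + \<theta>)) ^ n * \<Psi> x) \<longlonglongrightarrow> t * 0 * \<Psi> x"
    using \<theta> by (intro tendsto_intros LIMSEQ_power_zero) simp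
  then have "(\<lambda>n. t * (1 / (1 + \<theta>)) ^ n * \<Psi> x) \<longlonglongrightarrow> 0" by simp
  then show ?thesis
    by (rule LIMSEQ_le_const) (use iterate in blast)
qed

end

theorem theorem1p4:
  fixes s lam Lam :: real
    and LL :: "(('a::euclidean_space \<Rightarrow> real) \<Rightarrow> 'a \<Rightarrow> real) set"
    and \<Omega> :: "'a set"
  assumes "0 < s" and "s < 1"
    and "0 < lam" and "lam \<le> Lam"
    and "LL \<subseteq> L_star s lam Lam" and "LL \<noteq> {}"
    and "smooth_bounded_domain \<Omega>"
  shows "(\<forall>u \<mu>. continuous_on UNIV u \<and> u \<in> L1_weight s \<and>
            ereal \<mu> < Lambda_plus s LL \<Omega> \<and>
            visc_ge LL \<Omega> u (\<lambda>x. - \<mu> * u x) \<and> (\<forall>x\<in>- \<Omega>. u x \<le> 0)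
            \<longrightarrow> (\<forall>x. u x \<le> 0)) \<and>
         (\<forall>u \<mu>. continuous_on UNIV u \<and> u \<in> L1_weight s \<and>
            ereal \<mu> < Lambda_minus s LL \<Omega> \<and>
            visc_le LL \<Omega> u (\<lambda>x. - \<mu> * u x) \<and> (\<forall>x\<in>- \<Omega>. u x \<ge> 0)
            \<longrightarrow> (\<forall>x. u x \<ge> 0))"
proof -
  note s = assms(1,2) and lam = assms(3) and LL = assms(5,6)
  have \<Omega>: "open \<Omega>" "bounded \<Omega>" using assms(7) by (simp_all add: smooth_bounded_domain_def)
  have minus: "(\<lambda>x. - v x) \<in> L1_weight s" if "v \<in> L1_weight s" for v :: "'a \<Rightarrow> real"
    using that by (simp add: L1_weight_def)
  show ?thesis
  proof (intro conjI allI impI, goal_cases)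
    case (1 u \<mu> x)
    then obtain \<mu>' \<psi> where "\<mu> < \<mu>'" and \<psi>: "continuous_on UNIV \<psi>" "\<psi> \<in> L1_weight s"
      "\<And>x. 0 \<le> \<psi> x" "\<And>x. x \<in> \<Omega> \<Longrightarrow> 0 < \<psi> x" "visc_le LL \<Omega> \<psi> (\<lambda>x. - \<mu>' * \<psi> x)"
      unfolding Lambda_plus_def less_Sup_iff by auto
    moreover have "common_kernel s lam Lam \<Omega> u \<psi> \<mu> \<mu>'"
      using 1 \<psi> by (intro common_kernel_sup[OF s lam LL]) auto
    ultimately interpret subsolution_supersolution_pair s lam Lam \<mu> \<mu>' \<Omega> u \<psi>
      using 1 s lam \<Omega> by unfold_locales auto
    show ?case by (rule subsolution_nonpos)
  next
    case (2 u \<mu> x)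
    then obtain \<mu>' \<psi> where "\<mu> < \<mu>'" and \<psi>: "continuous_on UNIV \<psi>" "\<psi> \<in> L1_weight s"
      "\<And>x. \<psi> x \<le> 0" "\<And>x. x \<in> \<Omega> \<Longrightarrow> \<psi> x < 0" "visc_ge LL \<Omega> \<psi> (\<lambda>x. - \<mu>' * \<psi> x)"
      unfolding Lambda_minus_def less_Sup_iff by auto
    moreover have "common_kernel s lam Lam \<Omega> (\<lambda>x. - u x) (\<lambda>x. - \<psi> x) \<mu> \<mu>'"
      using 2 \<psi> by (intro common_kernel_inf[OF s lam LL]) auto
    ultimately interpret subsolution_supersolution_pair s lam Lam \<mu> \<mu>' \<Omega> "\<lambda>x. - u x" "\<lambda>x. - \<psi> x"
      using 2 s lam \<Omega> minus by unfold_locales (auto intro: continuous_on_minus)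
    show ?case using subsolution_nonpos[of x] by simp
  qed
qed

end
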